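(* Let $F(A)$ be the free group with basis $A$, let $H\leqslant F(A)$ be a finitely generated subgroup of rank $n$, and let $1\neq g\in F(A)$ be dependent on $H$, such that $\mathrm{rk}(\langle H,g\rangle)=m\leqslant n$. Then there exists an algorithm that, given a finite set of generators for $H$ and the element $g$, computes $n+1-m$ elements $w_1(x),\ldots,w_{n-m+1}(x)\in H*\langle x\rangle$ that generate $I_H(g)$ as a normal subgroup of $H*\langle x\rangle$: $$I_H(g)=\langle\langle w_1(x),\ldots,w_{n-m+1}(x)\rangle\rangle .$$
   Context: Let $H\leqslant F(A)$. $H*\langle x\rangle$ denotes the free product of $H$ with the infinite cyclic group generated by a variable $x$. For $w(x)\in H*\langle x\rangle$ and $g\in F(A)$, $w(g)\in F(A)$ denotes the image of $w(x)$ under the homomorphism $H*\langle x\rangle\to F(A)$ that is the inclusion on $H$ and maps $x\mapsto g$. The ideal of $g$ over $H$ is the normal subgroup $I_H(g)=\{w(x)\in H*\langle x\rangle\mid w(g)=1\}$ of $H*\langle x\rangle$. The element $g$ is dependent on $H$ if $I_H(g)\neq\{1\}$, i.e. there is a non-trivial $w(x)\in H*\langle x\rangle$ with $w(g)=1$. $\langle\langle S\rangle\rangle$ denotes the normal closure of $S$ in $H*\langle x\rangle$, and $\mathrm{rk}$ denotes the rank of a free group. *)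

theory Defs
  imports "HOL-Algebra.Algebra" "HOL-Library.Nat_Bijection"
begin

section \<open>Free groups\<close>

text \<open>Words over a set of letters: \<open>(a, True)\<close> stands for \<open>a\<close> and \<open>(a, False)\<close> for its inverse.
  The free group on \<open>A\<close> is the set of reduced words, multiplied by concatenation followed by
  cancellation.\<close>

type_synonym 'a word = "('a \<times> bool) list"

definition inv_letter :: "'a \<times> bool \<Rightarrow> 'a \<times> bool" where
  "inv_letter s = (fst s, \<not> snd s)"

definition reduced :: "'a word \<Rightarrow> bool" where
  "reduced w \<longleftrightarrow> successively (\<lambda>s t. t \<noteq> inv_letter s) w"

definition letters :: "'a word \<Rightarrow> 'a set" where
  "letters w = fst ` set w"

fun push_letter :: "'a \<times> bool \<Rightarrow> 'a word \<Rightarrow> 'a word" where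
  "push_letter s [] = [s]"
| "push_letter s (t # w) = (if t = inv_letter s then w else s # t # w)"

definition free_group :: "'a set \<Rightarrow> 'a word monoid" where
  "free_group A = \<lparr>carrier = {w. reduced w \<and> letters w \<subseteq> A},
                   monoid.mult = foldr push_letter, one = []\<rparr>"

definition word_value :: "('g, 'm) monoid_scheme \<Rightarrow> 'g word \<Rightarrow> 'g" where
  "word_value G w = foldr (\<lambda>(b, pos) u. (if pos then b else inv\<^bsub>G\<^esub> b) \<otimes>\<^bsub>G\<^esub> u) w \<one>\<^bsub>G\<^esub>"

definition free_basis :: "('g, 'm) monoid_scheme \<Rightarrow> 'g set \<Rightarrow> bool" where
  "free_basis G B \<longleftrightarrow> B \<subseteq> carrier G \<and> word_value G \<in> iso (free_group B) G"

definition has_rank :: "('g, 'm) monoid_scheme \<Rightarrow> nat \<Rightarrow> bool" where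
  "has_rank G n \<longleftrightarrow> (\<exists>B. free_basis G B \<and> finite B \<and> card B = n)"

lemma inv_letter_inv_letter [simp]: "inv_letter (inv_letter s) = s"
  by (simp add: inv_letter_def)

lemma fst_inv_letter [simp]: "fst (inv_letter s) = fst s"
  by (simp add: inv_letter_def)

lemma inv_letter_eq_iff: "t = inv_letter s \<longleftrightarrow> s = inv_letter t"
  by (metis inv_letter_inv_letter)

lemma reduced_Nil [simp]: "reduced []"
  by (simp add: reduced_def)

lemma reduced_Cons: "reduced (s # w) \<longleftrightarrow> (w = [] \<or> hd w \<noteq> inv_letter s) \<and> reduced w"
  by (auto simp: reduced_def successively_Cons)

lemma letters_simps [simp]: "letters [] = {}" "letters (s # w) = insert (fst s) (letters w)"
  by (auto simp: letters_def)

lemma reduced_push_letter: "reduced w \<Longrightarrow> reduced (push_letter s w)"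
  by (cases w) (auto simp: reduced_Cons)

lemma letters_push_letter: "letters (push_letter s w) \<subseteq> insert (fst s) (letters w)"
  by (cases w) auto

lemma push_letter_cancel: "reduced w \<Longrightarrow> push_letter s (push_letter (inv_letter s) w) = w"
  by (cases w; cases "tl w") (auto simp: reduced_Cons)

lemma push_letter_reduced: "reduced (s # w) \<Longrightarrow> push_letter s w = s # w"
  by (cases w) (auto simp: reduced_Cons)

lemma reduced_foldr: "reduced w \<Longrightarrow> reduced (foldr push_letter u w)"
  by (induction u) (auto simp: reduced_push_letter)

lemma letters_foldr: "letters (foldr push_letter u w) \<subseteq> letters u \<union> letters w"
  by (induction u) (use letters_push_letter in fastforce)+

lemma foldr_push_letter:
  assumes "reduced w"
  shows "foldr push_letter (push_letter s u) w = push_letter s (foldr push_letter u w)"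
proof (cases u)
  case (Cons t u')
  have "push_letter s (push_letter t (foldr push_letter u' w)) = foldr push_letter u' w"
    if "t = inv_letter s"
    using push_letter_cancel[OF reduced_foldr[OF assms]] that by blast
  then show ?thesis using Cons by auto
qed auto

lemma foldr_push_assoc:
  "reduced w \<Longrightarrow>
    foldr push_letter (foldr push_letter u v) w = foldr push_letter u (foldr push_letter v w)"
  by (induction u) (auto simp: foldr_push_letter)

lemma free_group_left_inverse:
  "reduced w \<Longrightarrow>
    \<exists>v. reduced v \<and> letters v \<subseteq> letters w \<and> foldr push_letter v w = []"
proof (induction w)
  case (Cons s w)
  then obtain v where v: "reduced v" "letters v \<subseteq> letters w" "foldr push_letter v w = []"
    by (auto simp: reduced_Cons)
  have "foldr push_letter (foldr push_letter v [inv_letter s]) (s # w) =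
        foldr push_letter v (push_letter (inv_letter s) (s # w))"
    using foldr_push_assoc[OF Cons.prems] by simp
  also have "\<dots> = []" using v by simp
  finally show ?case
    using reduced_foldr[of "[inv_letter s]" v] letters_foldr[of v "[inv_letter s]"] v(2)
    by (intro exI[of _ "foldr push_letter v [inv_letter s]"]) (auto simp: reduced_def)
qed (auto intro: exI[of _ "[]"])

lemma group_free_group: "group (free_group A)"
proof (rule groupI)
  fix x y assume "x \<in> carrier (free_group A)" "y \<in> carrier (free_group A)"
  then show "x \<otimes>\<^bsub>free_group A\<^esub> y \<in> carrier (free_group A)"
    using reduced_foldr[of y x] letters_foldr[of x y] by (auto simp: free_group_def)
next
  fix x assume x: "x \<in> carrier (free_group A)"
  then show "\<exists>y\<in>carrier (free_group A). y \<otimes>\<^bsub>free_group A\<^esub> x = \<one>\<^bsub>free_group A\<^esub>"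
    using free_group_left_inverse[of x] unfolding free_group_def by fastforce
qed (auto simp: free_group_def foldr_push_assoc)


section \<open>Free products\<close>

text \<open>Elements of the free product of \<open>G\<close> and \<open>K\<close> in normal form: lists of non-trivial syllables
  that come alternately from \<open>G\<close> (tag \<open>Inl\<close>) and from \<open>K\<close> (tag \<open>Inr\<close>). The function
  \<open>push_syllable\<close> is left multiplication of a normal form by an element of \<open>G\<close> or \<open>K\<close>.\<close>

definition cons_syllable ::
  "('g, 'm) monoid_scheme \<Rightarrow> ('k, 'n) monoid_scheme \<Rightarrow> 'g + 'k \<Rightarrow> ('g + 'k) list \<Rightarrow> ('g + 'k) list"
  where "cons_syllable G K s w = (if s = Inl \<one>\<^bsub>G\<^esub> \<or> s = Inr \<one>\<^bsub>K\<^esub> then w else s # w)"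

fun push_syllable ::
  "('g, 'm) monoid_scheme \<Rightarrow> ('k, 'n) monoid_scheme \<Rightarrow> 'g + 'k \<Rightarrow> ('g + 'k) list \<Rightarrow> ('g + 'k) list"
  where
  "push_syllable G K (Inl a) (Inl b # w) = cons_syllable G K (Inl (a \<otimes>\<^bsub>G\<^esub> b)) w"
| "push_syllable G K (Inr a) (Inr b # w) = cons_syllable G K (Inr (a \<otimes>\<^bsub>K\<^esub> b)) w"
| "push_syllable G K s w = cons_syllable G K s w"

definition free_product ::
  "('g, 'm) monoid_scheme \<Rightarrow> ('k, 'n) monoid_scheme \<Rightarrow> ('g + 'k) list monoid" where
  "free_product G K =
    \<lparr>carrier = {w. set w \<subseteq> Inl ` (carrier G - {\<one>\<^bsub>G\<^esub>}) \<union> Inr ` (carrier K - {\<one>\<^bsub>K\<^esub>}) \<and>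
                   successively (\<lambda>s t. isl s \<noteq> isl t) w},
     monoid.mult = foldr (push_syllable G K), one = []\<rparr>"

context
  fixes G :: "('g, 'm) monoid_scheme" and K :: "('k, 'n) monoid_scheme"
  assumes G: "group G" and K: "group K"
begin

interpretation G: group G by (rule G)
interpretation K: group K by (rule K)

private abbreviation (input) "P \<equiv> carrier (free_product G K)"
private abbreviation (input) "S \<equiv> Inl ` carrier G \<union> Inr ` carrier K"
private abbreviation (input) "push \<equiv> push_syllable G K"

private lemma Nil_P: "[] \<in> P"
  by (simp add: free_product_def)

private lemma Cons_P:
  "s # w \<in> P \<longleftrightarrow> s \<in> S \<and> s \<noteq> Inl \<one>\<^bsub>G\<^esub> \<and> s \<noteq> Inr \<one>\<^bsub>K\<^esub> \<and> (w = [] \<or> isl s \<noteq> isl (hd w)) \<and> w \<in> P"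
  by (cases s) (auto simp: free_product_def successively_Cons)

private lemma push_P:
  assumes "s \<in> S" "w \<in> P" shows "push s w \<in> P"
proof (cases w)
  case Nil
  then show ?thesis using assms by (auto simp: cons_syllable_def Cons_P Nil_P)
next
  case (Cons t w')
  then show ?thesis using assms
    by (cases s; cases t) (auto simp: cons_syllable_def Cons_P)
qed

private lemma foldr_P: "set u \<subseteq> S \<Longrightarrow> w \<in> P \<Longrightarrow> foldr push u w \<in> P"
  by (induction u) (auto intro!: push_P)

private lemma P_S: "w \<in> P \<Longrightarrow> set w \<subseteq> S"
  by (auto simp: free_product_def)

private lemma push_one:
  "w \<in> P \<Longrightarrow> push (Inl \<one>\<^bsub>G\<^esub>) w = w" "w \<in> P \<Longrightarrow> push (Inr \<one>\<^bsub>K\<^esub>) w = w"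
  by (cases w rule: list.exhaust; cases "hd w"; force simp: cons_syllable_def Cons_P)+

private lemma push_push_Inl:
  assumes a: "a \<in> carrier G" and b: "b \<in> carrier G" and w: "w \<in> P"
  shows "push (Inl a) (push (Inl b) w) = push (Inl (a \<otimes>\<^bsub>G\<^esub> b)) w"
proof -
  consider (nil) "w = []" | (l) c w' where "w = Inl c # w'" | (r) c w' where "w = Inr c # w'"
    by (metis list.exhaust sum.exhaust)
  then show ?thesis
  proof cases
    case nil then show ?thesis using a b by (auto simp: cons_syllable_def)
  next
    case r then show ?thesis using a b by (auto simp: cons_syllable_def)
  next
    case l
    then have c: "c \<in> carrier G" and w': "w' = [] \<or> \<not> isl (hd w')" using w by (auto simp: Cons_P)
    have "push (Inl a) w' = cons_syllable G K (Inl a) w'"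
      using w' by (cases w'; cases "hd w'") auto
    moreover have "a \<otimes>\<^bsub>G\<^esub> b \<otimes>\<^bsub>G\<^esub> c = a" if "b \<otimes>\<^bsub>G\<^esub> c = \<one>\<^bsub>G\<^esub>"
      using that a b c by (simp add: G.m_assoc)
    ultimately show ?thesis using l a b c by (auto simp: cons_syllable_def G.m_assoc)
  qed
qed

private lemma push_push_Inr:
  assumes a: "a \<in> carrier K" and b: "b \<in> carrier K" and w: "w \<in> P"
  shows "push (Inr a) (push (Inr b) w) = push (Inr (a \<otimes>\<^bsub>K\<^esub> b)) w"
proof -
  consider (nil) "w = []" | (r) c w' where "w = Inr c # w'" | (l) c w' where "w = Inl c # w'"
    by (metis list.exhaust sum.exhaust)
  then show ?thesis
  proof cases
    case nil then show ?thesis using a b by (auto simp: cons_syllable_def)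
  next
    case l then show ?thesis using a b by (auto simp: cons_syllable_def)
  next
    case r
    then have c: "c \<in> carrier K" and w': "w' = [] \<or> isl (hd w')" using w by (auto simp: Cons_P)
    have "push (Inr a) w' = cons_syllable G K (Inr a) w'"
      using w' by (cases w'; cases "hd w'") auto
    moreover have "a \<otimes>\<^bsub>K\<^esub> b \<otimes>\<^bsub>K\<^esub> c = a" if "b \<otimes>\<^bsub>K\<^esub> c = \<one>\<^bsub>K\<^esub>"
      using that a b c by (simp add: K.m_assoc)
    ultimately show ?thesis using r a b c by (auto simp: cons_syllable_def K.m_assoc)
  qed
qed

private lemma foldr_cons_syllable:
  assumes "w \<in> P" "set u \<subseteq> S"
  shows "foldr push (cons_syllable G K s u) w = push s (foldr push u w)"
  using push_one foldr_P[OF assms(2,1)] by (auto simp: cons_syllable_def)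

private lemma foldr_push:
  assumes w: "w \<in> P" and u: "u \<in> P" and s: "s \<in> S"
  shows "foldr push (push s u) w = push s (foldr push u w)"
proof (cases u)
  case Nil then show ?thesis using w by (cases s) (auto simp: foldr_cons_syllable)
next
  case (Cons t u')
  have u': "foldr push u' w \<in> P" "set u' \<subseteq> S" "t \<in> S" "set (t # u') \<subseteq> S"
    using Cons u w P_S foldr_P by (auto simp: Cons_P)
  show ?thesis
  proof (cases "isl s = isl t")
    case True
    then show ?thesis using Cons u' s w
      by (cases s; cases t) (auto simp: foldr_cons_syllable push_push_Inl push_push_Inr)
  next
    case False
    then have "push s u = cons_syllable G K s u" using Cons by (cases s; cases t) auto
    then show ?thesis using Cons u' w by (simp only: foldr_cons_syllable)
  qed
qed

private lemma foldr_assoc: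
  assumes "w \<in> P" "v \<in> P" "set u \<subseteq> S"
  shows "foldr push (foldr push u v) w = foldr push u (foldr push v w)"
  using assms(3) by (induction u) (auto simp: foldr_push[OF assms(1)] foldr_P[OF _ assms(2)])

private lemma left_inverse: "w \<in> P \<Longrightarrow> \<exists>v\<in>P. foldr push v w = []"
proof (induction w)
  case Nil then show ?case by (intro bexI[of _ "[]"]) (auto simp: Nil_P)
next
  case (Cons s w)
  then obtain v where v: "v \<in> P" "foldr push v w = []" and w: "w \<in> P" by (auto simp: Cons_P)
  obtain t where t: "t \<in> S" "push t (s # w) = w"
  proof (cases s)
    case (Inl a)
    then show ?thesis using Cons.prems that[of "Inl (inv\<^bsub>G\<^esub> a)"]
      by (auto simp: Cons_P cons_syllable_def)
  next
    case (Inr a)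
    then show ?thesis using Cons.prems that[of "Inr (inv\<^bsub>K\<^esub> a)"]
      by (auto simp: Cons_P cons_syllable_def)
  qed
  have tP: "push t [] \<in> P" using push_P[OF t(1) Nil_P] .
  have "foldr push (foldr push v (push t [])) (s # w) = foldr push v (foldr push (push t []) (s # w))"
    using foldr_assoc[OF Cons.prems tP P_S[OF v(1)]] .
  also have "\<dots> = []" using foldr_push[OF Cons.prems Nil_P t(1)] t(2) v(2) by simp
  finally show ?case using foldr_P[OF P_S[OF v(1)] tP] by blast
qed

lemma group_free_product: "group (free_product G K)"
proof (rule groupI)
  fix x y z
  assume x: "x \<in> P" and y: "y \<in> P" and z: "z \<in> P"
  show "x \<otimes>\<^bsub>free_product G K\<^esub> y \<otimes>\<^bsub>free_product G K\<^esub> z =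
        x \<otimes>\<^bsub>free_product G K\<^esub> (y \<otimes>\<^bsub>free_product G K\<^esub> z)"
    using foldr_assoc[OF z y P_S[OF x]] by (simp add: free_product_def)
next
  fix x y assume "x \<in> P" "y \<in> P"
  then show "x \<otimes>\<^bsub>free_product G K\<^esub> y \<in> P"
    using foldr_P[OF P_S] by (simp add: free_product_def)
next
  fix x assume "x \<in> P"
  then show "\<exists>y\<in>P. y \<otimes>\<^bsub>free_product G K\<^esub> x = \<one>\<^bsub>free_product G K\<^esub>"
    using left_inverse by (simp add: free_product_def)
qed (auto simp: free_product_def)

end


section \<open>Ideals of elements over subgroups\<close>

text \<open>The free product of the subgroup \<open>H\<close> of \<open>G\<close> with an infinite cyclic group; the variable
  \<open>x\<close> is the generator \<open>1\<close> of the second factor, so \<open>Inr k\<close> is the syllable \<open>x\<^sup>k\<close>.\<close>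

definition adjoin_variable :: "('g, 'm) monoid_scheme \<Rightarrow> 'g set \<Rightarrow> ('g + int) list monoid" where
  "adjoin_variable G H = free_product (subgroup_generated G H) integer_group"

definition evaluate :: "('g, 'm) monoid_scheme \<Rightarrow> 'g \<Rightarrow> ('g + int) list \<Rightarrow> 'g" where
  "evaluate G g w =
    foldr (\<lambda>s u. (case s of Inl h \<Rightarrow> h | Inr k \<Rightarrow> g [^]\<^bsub>G\<^esub> k) \<otimes>\<^bsub>G\<^esub> u) w \<one>\<^bsub>G\<^esub>"

definition ideal_over :: "('g, 'm) monoid_scheme \<Rightarrow> 'g set \<Rightarrow> 'g \<Rightarrow> ('g + int) list set" where
  "ideal_over G H g = {w \<in> carrier (adjoin_variable G H). evaluate G g w = \<one>\<^bsub>G\<^esub>}"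

definition dependent_on :: "('g, 'm) monoid_scheme \<Rightarrow> 'g set \<Rightarrow> 'g \<Rightarrow> bool" where
  "dependent_on G H g \<longleftrightarrow> ideal_over G H g \<noteq> {\<one>\<^bsub>adjoin_variable G H\<^esub>}"

definition normal_closure :: "('g, 'm) monoid_scheme \<Rightarrow> 'g set \<Rightarrow> 'g set" where
  "normal_closure G R = \<Inter> {N. N \<lhd> G \<and> R \<subseteq> N}"

lemma group_adjoin_variable: "group G \<Longrightarrow> group (adjoin_variable G H)"
  unfolding adjoin_variable_def
  by (intro group_free_product group.group_subgroup_generated) auto

lemma evaluate_inclusion:
  "group G \<Longrightarrow> subgroup H G \<Longrightarrow> h \<in> H \<Longrightarrow> evaluate G g [Inl h] = h"
  by (simp add: evaluate_def group.is_monoid monoid.r_one subgroup.mem_carrier)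

lemma evaluate_variable: "group G \<Longrightarrow> g \<in> carrier G \<Longrightarrow> evaluate G g [Inr 1] = g"
  by (simp add: evaluate_def group.int_pow_1 group.is_monoid monoid.r_one)

lemma evaluate_hom:
  assumes G: "group G" and H: "subgroup H G" and g: "g \<in> carrier G"
  shows "evaluate G g \<in> hom (adjoin_variable G H) G"
proof -
  interpret G: group G by (rule G)
  have HG: "H \<subseteq> carrier G" using H by (rule subgroup.subset)
  have cH: "carrier (subgroup_generated G H) = H"
    using H by (rule subgroup.carrier_subgroup_generated_subgroup)
  define val :: "'a + int \<Rightarrow> 'a" where "val s = (case s of Inl h \<Rightarrow> h | Inr k \<Rightarrow> g [^]\<^bsub>G\<^esub> k)" for s
  let ?S = "Inl ` H \<union> range Inr :: ('a + int) set"
  let ?push = "push_syllable (subgroup_generated G H) integer_group"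
  have ev_Nil: "evaluate G g [] = \<one>\<^bsub>G\<^esub>" by (simp add: evaluate_def)
  have ev_Cons: "evaluate G g (s # w) = val s \<otimes>\<^bsub>G\<^esub> evaluate G g w" for s w
    by (simp add: evaluate_def val_def)
  have val: "val s \<in> carrier G" if "s \<in> ?S" for s
    using that HG g by (auto simp: val_def)
  have ev: "evaluate G g w \<in> carrier G" if "set w \<subseteq> ?S" for w
    using that by (induction w) (auto simp: ev_Nil ev_Cons val)
  have ev_cons: "evaluate G g (cons_syllable (subgroup_generated G H) integer_group s w) =
      val s \<otimes>\<^bsub>G\<^esub> evaluate G g w" if "set w \<subseteq> ?S" for s w
    using ev[OF that] by (auto simp: cons_syllable_def ev_Cons val_def)
  have ev_push: "evaluate G g (?push s w) = val s \<otimes>\<^bsub>G\<^esub> evaluate G g w"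
    if s: "s \<in> ?S" and w: "set w \<subseteq> ?S" for s w
  proof (cases w)
    case Nil then show ?thesis by (cases s) (simp_all add: ev_cons)
  next
    case (Cons t w')
    have t: "t \<in> ?S" and w': "set w' \<subseteq> ?S" using w Cons by auto
    show ?thesis
    proof (cases "isl s = isl t")
      case True
      then consider (l) a b where "s = Inl a" "t = Inl b" | (r) a b where "s = Inr a" "t = Inr b"
        by (metis isl_def sum.exhaust sum.disc(2))
      then show ?thesis
      proof cases
        case l
        then have "a \<in> carrier G" "b \<in> carrier G" using s t HG by auto
        then show ?thesis using l Cons ev[OF w'] w'
          by (simp add: ev_cons ev_Cons val_def G.m_assoc)
      next
        case r
        have "g [^]\<^bsub>G\<^esub> (a + b) \<otimes>\<^bsub>G\<^esub> evaluate G g w' =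
              g [^]\<^bsub>G\<^esub> a \<otimes>\<^bsub>G\<^esub> (g [^]\<^bsub>G\<^esub> b \<otimes>\<^bsub>G\<^esub> evaluate G g w')"
          using ev[OF w'] g by (simp add: G.int_pow_mult G.m_assoc)
        then show ?thesis using r Cons w' by (simp add: ev_cons ev_Cons val_def)
      qed
    next
      case False
      then have "?push s w = cons_syllable (subgroup_generated G H) integer_group s w"
        using Cons by (cases s; cases t) auto
      then show ?thesis using ev_cons[OF w] by simp
    qed
  qed
  have cons_S: "set (cons_syllable (subgroup_generated G H) integer_group s w) \<subseteq> ?S"
    if "s \<in> ?S" "set w \<subseteq> ?S" for s w
    using that by (auto simp: cons_syllable_def)
  have push_S: "set (?push s w) \<subseteq> ?S" if s: "s \<in> ?S" and w: "set w \<subseteq> ?S" for s w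
  proof -
    consider (l) a b w' where "s = Inl a" "w = Inl b # w'"
      | (r) a b w' where "s = Inr a" "w = Inr b # w'"
      | (other) "?push s w = cons_syllable (subgroup_generated G H) integer_group s w"
      by (cases s; cases w; cases "hd w") auto
    then show ?thesis
    proof cases
      case l
      then have "a \<otimes>\<^bsub>G\<^esub> b \<in> H" using s w subgroup.m_closed[OF H] by auto
      then show ?thesis using l w by (simp only: push_syllable.simps mult_subgroup_generated) (intro cons_S, auto)
    next
      case r
      then show ?thesis using w by (simp only: push_syllable.simps) (intro cons_S, auto)
    next
      case other
      show ?thesis unfolding other using s w by (rule cons_S)
    qed
  qed
  have fold_S: "set (foldr ?push u w) \<subseteq> ?S" if "set u \<subseteq> ?S" "set w \<subseteq> ?S" for u w
    using that(1)
  proof (induction u)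
    case Nil then show ?case using that(2) by simp
  next
    case (Cons s u)
    then show ?case using push_S[of s "foldr ?push u w"] by simp
  qed
  have ev_fold: "evaluate G g (foldr ?push u w) = evaluate G g u \<otimes>\<^bsub>G\<^esub> evaluate G g w"
    if "set u \<subseteq> ?S" "set w \<subseteq> ?S" for u w
    using that(1)
  proof (induction u)
    case Nil then show ?case using ev[OF that(2)] by (simp add: ev_Nil)
  next
    case (Cons s u)
    then have s: "s \<in> ?S" and u: "set u \<subseteq> ?S" by auto
    have "evaluate G g (foldr ?push (s # u) w) = val s \<otimes>\<^bsub>G\<^esub> evaluate G g (foldr ?push u w)"
      using ev_push[OF s fold_S[OF u that(2)]] by simp
    also have "\<dots> = evaluate G g (s # u) \<otimes>\<^bsub>G\<^esub> evaluate G g w"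
      using Cons.IH[OF u] ev[OF u] ev[OF that(2)] val[OF s] by (simp add: ev_Cons G.m_assoc)
    finally show ?case .
  qed
  have "set w \<subseteq> ?S" if "w \<in> carrier (adjoin_variable G H)" for w
    using that by (auto simp: adjoin_variable_def free_product_def cH)
  then show ?thesis
    using ev ev_fold by (intro homI) (auto simp: adjoin_variable_def free_product_def)
qed


section \<open>Algorithms\<close>

text \<open>Partial recursive functions of one argument, where the Cantor pairing \<open>prod_encode\<close> replaces
  functions of several arguments. Undefined values are \<open>None\<close>.\<close>

inductive partial_recursive :: "(nat \<Rightarrow> nat option) \<Rightarrow> bool" where
  zero: "partial_recursive (\<lambda>_. Some 0)"
| succ: "partial_recursive (\<lambda>n. Some (Suc n))"
| left: "partial_recursive (\<lambda>n. Some (fst (prod_decode n)))"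
| right: "partial_recursive (\<lambda>n. Some (snd (prod_decode n)))"
| pair: "partial_recursive f \<Longrightarrow> partial_recursive g \<Longrightarrow>
    partial_recursive
      (\<lambda>n. Option.bind (f n) (\<lambda>a. Option.bind (g n) (\<lambda>b. Some (prod_encode (a, b)))))"
| comp: "partial_recursive f \<Longrightarrow> partial_recursive g \<Longrightarrow>
    partial_recursive (\<lambda>n. Option.bind (g n) f)"
| prim_rec: "partial_recursive f \<Longrightarrow> partial_recursive g \<Longrightarrow>
    partial_recursive (\<lambda>n. case prod_decode n of (a, k) \<Rightarrow>
      rec_nat (f a) (\<lambda>i r. Option.bind r (\<lambda>v. g (prod_encode (a, prod_encode (i, v))))) k)"
| minimize: "partial_recursive f \<Longrightarrow>
    partial_recursive (\<lambda>a.
      if \<exists>k. f (prod_encode (a, k)) = Some 0 \<and> (\<forall>j<k. f (prod_encode (a, j)) \<noteq> None)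
      then Some (LEAST k. f (prod_encode (a, k)) = Some 0) else None)"

text \<open>Codes of the data that an algorithm reads and writes. A letter is presented to it through a
  numbering \<open>e\<close> of letters; only the values of \<open>e\<close> on the letters that occur matter.\<close>

definition word_code :: "('a \<Rightarrow> nat) \<Rightarrow> 'a word \<Rightarrow> nat" where
  "word_code e w = list_encode (map (\<lambda>(a, pos). prod_encode (e a, of_bool pos)) w)"

definition input_code :: "('a \<Rightarrow> nat) \<Rightarrow> 'a word list \<Rightarrow> 'a word \<Rightarrow> nat" where
  "input_code e hs g = prod_encode (list_encode (map (word_code e) hs), word_code e g)"

definition syllable_code :: "('a \<Rightarrow> nat) \<Rightarrow> 'a word + int \<Rightarrow> nat" where
  "syllable_code e s =
    sum_encode (case s of Inl h \<Rightarrow> Inl (word_code e h) | Inr k \<Rightarrow> Inr (int_encode k))"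

definition output_code :: "('a \<Rightarrow> nat) \<Rightarrow> ('a word + int) list list \<Rightarrow> nat" where
  "output_code e ws = list_encode (map (\<lambda>w. list_encode (map (syllable_code e) w)) ws)"

end

theory Submission
  imports Defs
begin

text \<open>Nielsen moves turn generators of \<open>H\<close> into a free basis \<open>c\<^sub>1, \<dots>, c\<^sub>n\<close>, up to trivial words. Further
  moves turn the tuple \<open>g, c\<^sub>1, \<dots>, c\<^sub>n\<close> into a free basis of \<open>\<langle>H, g\<rangle>\<close> together with trivial words.
  The same moves applied to \<open>x, c\<^sub>1, \<dots>, c\<^sub>n\<close> give generators of \<open>H * \<langle>x\<rangle>\<close>, of which \<open>m\<close> are mapped to a
  free basis by \<open>x \<mapsto> g\<close> and \<open>n + 1 - m\<close> are mapped to \<open>1\<close>; modulo the latter, the map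
  is injective, so they generate the ideal as a normal subgroup.

  The reduction is found by unbounded search: freeness of a tuple of words is witnessed by a marked
  letter in each word that no product can cancel, which is decidable. A tuple that no move makes
  smaller (by length, then by the lexicographic order of initial halves) has such marks.\<close>

section \<open>Computable functions on encodable types\<close>

text \<open>Nielsen reduction proper uses an order on the letters and a termination argument, and a
  recursive function performing it would have to carry both. The search avoids this. Its candidates
  are lists of moves and positions of marks, pure data about indices and signs, and a candidate is
  checked by free cancellation alone; order and termination enter only the proof that an accepted
  candidate exists. The ranks \<open>n\<close> and \<open>m\<close> are not part of the input
  either: an accepted candidate exhibits free bases of both subgroups, and uniqueness of ranks
  identifies their sizes. Letters of an arbitrary type reach the algorithm only as numbers, under a
  numbering that is injective on the letters that occur. The search therefore runs on words over the
  natural numbers. Its check compares letters only for equality, so a candidate is accepted before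
  renaming exactly if it is accepted afterwards, and the relators are renamed along. One list of
  moves must act both in the free group and in \<open>H * <x>\<close>; moves are therefore defined
  for arbitrary operations and run on pairs of an element and its value.\<close>

class encodable =
  fixes enc :: "'a \<Rightarrow> nat"
  assumes enc_inj: "enc x = enc y \<Longrightarrow> x = y"

lemma enc_eq_iff [simp]: "enc x = enc y \<longleftrightarrow> x = y"
  using enc_inj by blast

text \<open>The instances repeat the codes by which data reach the algorithm, so that on words over
  the natural numbers \<open>enc\<close> agrees with \<open>word_code\<close>,
  \<open>syllable_code\<close> and the list codes built from them, taken with the identity
  numbering.\<close>

instantiation nat :: encodable
begin
definition enc_nat :: "nat \<Rightarrow> nat" where [simp]: "enc_nat n = n"
instance by standard simp
end

instantiation bool :: encodable
begin
definition enc_bool :: "bool \<Rightarrow> nat" where [simp]: "enc_bool b = of_bool b"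
instance by standard (simp add: of_bool_eq_iff)
end

instantiation int :: encodable
begin
definition enc_int :: "int \<Rightarrow> nat" where "enc_int = int_encode"
instance by standard (simp add: enc_int_def inj_eq[OF inj_int_encode])
end

instantiation prod :: (encodable, encodable) encodable
begin
definition enc_prod :: "'a \<times> 'b \<Rightarrow> nat" where
  [simp]: "enc_prod p = prod_encode (enc (fst p), enc (snd p))"
instance by standard (auto simp: prod_eq_iff)
end

instantiation sum :: (encodable, encodable) encodable
begin
definition enc_sum :: "'a + 'b \<Rightarrow> nat" where
  [simp]: "enc_sum s = sum_encode (map_sum enc enc s)"
instance
proof
  fix x y :: "'a + 'b" assume "enc x = enc y"
  then show "x = y" by (cases x; cases y) (auto simp: inj_eq[OF inj_sum_encode])
qed
end

instantiation list :: (encodable) encodable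
begin
definition enc_list :: "'a list \<Rightarrow> nat" where [simp]: "enc_list xs = list_encode (map enc xs)"
instance by standard (simp add: inj_eq[OF inj_list_encode] inj_map_eq_map inj_def)
end

section \<open>Total recursive functions on numbers\<close>

definition total_recursive :: "(nat \<Rightarrow> nat) \<Rightarrow> bool" where
  "total_recursive p \<longleftrightarrow> partial_recursive (\<lambda>n. Some (p n))"

lemma total_recursive_comp:
  assumes "total_recursive f" "total_recursive g" shows "total_recursive (\<lambda>n. f (g n))"
  using partial_recursive.comp[OF assms[unfolded total_recursive_def]]
  by (simp add: total_recursive_def)

lemma total_recursive_pair:
  assumes "total_recursive f" "total_recursive g"
  shows "total_recursive (\<lambda>n. prod_encode (f n, g n))"
  using partial_recursive.pair[OF assms[unfolded total_recursive_def]]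
  by (simp add: total_recursive_def)

lemma total_recursive_Suc: "total_recursive Suc"
  and total_recursive_fst: "total_recursive (\<lambda>n. fst (prod_decode n))"
  and total_recursive_snd: "total_recursive (\<lambda>n. snd (prod_decode n))"
  by (simp_all add: total_recursive_def partial_recursive.intros)

lemma total_recursive_id: "total_recursive (\<lambda>n. n)"
  using total_recursive_pair[OF total_recursive_fst total_recursive_snd] by simp

lemma total_recursive_const: "total_recursive (\<lambda>_. k)"
proof (induction k)
  case 0 then show ?case by (simp add: total_recursive_def partial_recursive.zero)
next
  case (Suc k) then show ?case using total_recursive_comp[OF total_recursive_Suc] by blast
qed

text \<open>The scheme \<open>prim_rec\<close> recurses on the second half of its argument; feeding
  it the pair of \<open>n\<close> and \<open>k n\<close> makes the depth of the recursion a function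
  of the input, which also stays available as the parameter.\<close>

lemma total_recursive_rec_nat:
  assumes f: "total_recursive f" and g: "total_recursive g" and k: "total_recursive k"
  shows "total_recursive (\<lambda>n. rec_nat (f n) (\<lambda>i v. g (prod_encode (n, prod_encode (i, v)))) (k n))"
proof -
  have "rec_nat (Some (f a)) (\<lambda>i r. Option.bind r (\<lambda>v. Some (g (prod_encode (a, prod_encode (i, v)))))) k
      = Some (rec_nat (f a) (\<lambda>i v. g (prod_encode (a, prod_encode (i, v)))) k)" for a k
    by (induction k) auto
  then have "total_recursive (\<lambda>n. case prod_decode n of (a, k) \<Rightarrow>
      rec_nat (f a) (\<lambda>i v. g (prod_encode (a, prod_encode (i, v)))) k)"
    using partial_recursive.prim_rec[OF f[unfolded total_recursive_def] g[unfolded total_recursive_def]]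
    by (simp add: total_recursive_def case_prod_unfold)
  from total_recursive_comp[OF this total_recursive_pair[OF total_recursive_id k]] show ?thesis
    by simp
qed

text \<open>The function \<open>p\<close> is total even on numbers that encode nothing, so that the unused branch of
  a case distinction never diverges.\<close>

definition computable :: "('a::encodable \<Rightarrow> 'b::encodable) \<Rightarrow> bool" where
  "computable f \<longleftrightarrow> (\<exists>p. total_recursive p \<and> (\<forall>x. p (enc x) = enc (f x)))"

named_theorems computable_intros

lemma computable_nat: "computable p \<longleftrightarrow> total_recursive p" for p :: "nat \<Rightarrow> nat"
proof
  assume "computable p"
  then obtain q where "total_recursive q" "\<forall>x. q x = p x"
    unfolding computable_def enc_nat_def by blast
  moreover from this(2) have "q = p" by (intro ext) blast
  ultimately show "total_recursive p" by simp
next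
  assume "total_recursive p"
  then show "computable p" unfolding computable_def by (intro exI[of _ p]) simp
qed

lemma computableI:
  assumes "computable (p :: nat \<Rightarrow> nat)" "\<And>x. p (enc x) = enc (f x)" shows "computable f"
  using assms unfolding computable_nat unfolding computable_def by (intro exI[of _ p]) simp

lemma computableE:
  assumes "computable f"
  obtains p :: "nat \<Rightarrow> nat" where "computable p" "\<And>x. p (enc x) = enc (f x)"
  using assms unfolding computable_nat unfolding computable_def by blast

lemma computable_id [computable_intros]: "computable (\<lambda>c. c)"
  by (rule computableI[of "\<lambda>n. n"]) (simp_all add: computable_nat total_recursive_id)

lemma computable_const [computable_intros]: "computable (\<lambda>c. k)"
  by (rule computableI[of "\<lambda>n. enc k"]) (simp_all add: computable_nat total_recursive_const)

lemma computable_comp: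
  assumes "computable f" "computable g" shows "computable (\<lambda>c. f (g c))"
proof -
  obtain p q where "total_recursive p" "\<forall>x. p (enc x) = enc (f x)"
    "total_recursive q" "\<forall>x. q (enc x) = enc (g x)" using assms unfolding computable_def by blast
  then show ?thesis unfolding computable_def
    by (intro exI[of _ "\<lambda>n. p (q n)"]) (simp add: total_recursive_comp[of p q])
qed

text \<open>A map that leaves codes unchanged costs nothing: the recursive function for
  \<open>f\<close> also represents \<open>h\<close> after \<open>f\<close>. Such maps are
  \<open>of_bool\<close>, \<open>enc\<close> itself, \<open>prod_encode\<close> and
  \<open>list_decode\<close>.\<close>

lemma computable_enc_eq:
  assumes "\<And>x. enc (h x) = enc x" "computable f" shows "computable (\<lambda>c. h (f c))"
  using assms unfolding computable_def by (metis (no_types))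

lemma computable_Pair [computable_intros]:
  assumes "computable f" "computable g" shows "computable (\<lambda>c. (f c, g c))"
proof -
  obtain p :: "nat \<Rightarrow> nat" where p: "computable p" "\<And>x. p (enc x) = enc (f x)"
    by (rule computableE[OF assms(1)]) blast
  obtain q :: "nat \<Rightarrow> nat" where q: "computable q" "\<And>x. q (enc x) = enc (g x)"
    by (rule computableE[OF assms(2)]) blast
  show ?thesis
  proof (rule computableI)
    show "computable (\<lambda>n. prod_encode (p n, q n))"
      using p(1) q(1) unfolding computable_nat by (rule total_recursive_pair)
  qed (simp add: p(2) q(2))
qed

lemma computable_fst [computable_intros]:
  fixes f :: "'a::encodable \<Rightarrow> 'b::encodable \<times> 'c::encodable"
  assumes "computable f" shows "computable (\<lambda>c. fst (f c))"
proof -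
  have "computable (\<lambda>n. fst (prod_decode n))" by (simp only: computable_nat total_recursive_fst)
  then have "computable (fst :: 'b \<times> 'c \<Rightarrow> 'b)" by (rule computableI) simp
  from computable_comp[OF this assms] show ?thesis .
qed

lemma computable_snd [computable_intros]:
  fixes f :: "'a::encodable \<Rightarrow> 'c::encodable \<times> 'b::encodable"
  assumes "computable f" shows "computable (\<lambda>c. snd (f c))"
proof -
  have "computable (\<lambda>n. snd (prod_decode n))" by (simp only: computable_nat total_recursive_snd)
  then have "computable (snd :: 'c \<times> 'b \<Rightarrow> 'b)" by (rule computableI) simp
  from computable_comp[OF this assms] show ?thesis .
qed

lemma computable_case_prod [computable_intros]:
  assumes "computable p" "computable (\<lambda>z. f (fst z) (fst (snd z)) (snd (snd z)))"
  shows "computable (\<lambda>c. case p c of (x, y) \<Rightarrow> f c x y)"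
  using computable_comp[OF assms(2) computable_Pair[OF computable_id assms(1)]]
  by (simp add: case_prod_unfold)

lemma computable_prod_encode [computable_intros]:
  "computable f \<Longrightarrow> computable g \<Longrightarrow> computable (\<lambda>c. prod_encode (f c, g c))"
  by (rule computable_enc_eq[of prod_encode, OF _ computable_Pair]) simp_all

lemma computable_Suc [computable_intros]: "computable f \<Longrightarrow> computable (\<lambda>c. Suc (f c))"
  by (rule computable_comp[where f = Suc]) (simp_all add: computable_nat total_recursive_Suc)

lemma computable_rec_nat [computable_intros]:
  assumes "computable a" "computable (\<lambda>z. s (fst z) (fst (snd z)) (snd (snd z)))" "computable k"
  shows "computable (\<lambda>c. rec_nat (a c) (s c) (k c))"
proof -
  obtain pa :: "nat \<Rightarrow> nat" where a: "computable pa" "\<And>x. pa (enc x) = enc (a x)"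
    by (rule computableE[OF assms(1)]) blast
  obtain ps :: "nat \<Rightarrow> nat"
    where s: "computable ps" "\<And>z. ps (enc z) = enc (s (fst z) (fst (snd z)) (snd (snd z)))"
    by (rule computableE[OF assms(2)]) blast
  obtain pk :: "nat \<Rightarrow> nat" where k: "computable pk" "\<And>x. pk (enc x) = enc (k x)"
    by (rule computableE[OF assms(3)]) blast
  have s': "ps (prod_encode (enc c, prod_encode (i, enc v))) = enc (s c i v)" for c i v
    using s(2)[of "(c, i, v)"] by simp
  have "rec_nat (enc (a c)) (\<lambda>i v. ps (prod_encode (enc c, prod_encode (i, v)))) j
      = enc (rec_nat (a c) (s c) j)" for c j
    by (induction j) (auto simp: s')
  note eq = this
  show ?thesis
  proof (rule computableI)
    show "computable (\<lambda>n. rec_nat (pa n) (\<lambda>i v. ps (prod_encode (n, prod_encode (i, v)))) (pk n))"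
      using a(1) s(1) k(1) unfolding computable_nat by (rule total_recursive_rec_nat)
  qed (use eq a(2) k(2) in simp)
qed

lemma computable_case_nat [computable_intros]:
  assumes "computable k" "computable a" "computable (\<lambda>z. s (fst z) (snd z))"
  shows "computable (\<lambda>c. case k c of 0 \<Rightarrow> a c | Suc i \<Rightarrow> s c i)"
proof -
  have "computable (\<lambda>c. rec_nat (a c) (\<lambda>i _. s c i) (k c))"
    using computable_comp[OF assms(3), of "\<lambda>z. (fst z, fst (snd z))"]
    by (intro computable_intros assms) (simp add: computable_intros)
  moreover have "rec_nat (a c) (\<lambda>i _. s c i) (k c) = (case k c of 0 \<Rightarrow> a c | Suc i \<Rightarrow> s c i)" for c
    by (cases "k c") auto
  ultimately show ?thesis by simp
qed

lemma computable_If [computable_intros]: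
  assumes "computable b" "computable x" "computable y"
  shows "computable (\<lambda>c. if b c then x c else y c)"
proof -
  have "computable (\<lambda>c. case (of_bool (b c) :: nat) of 0 \<Rightarrow> y c | Suc _ \<Rightarrow> x c)"
    by (intro computable_intros assms computable_enc_eq[of of_bool] computable_comp[OF assms(2)]) auto
  moreover have "(case (of_bool (b c) :: nat) of 0 \<Rightarrow> y c | Suc _ \<Rightarrow> x c) = (if b c then x c else y c)" for c
    by auto
  ultimately show ?thesis by simp
qed

lemma computable_conj [computable_intros]:
  assumes "computable f" "computable g" shows "computable (\<lambda>c. f c \<and> g c)"
proof -
  have eq: "f c \<and> g c \<longleftrightarrow> (if f c then g c else False)" for c by simp
  show ?thesis unfolding eq by (intro computable_intros assms)
qed

lemma computable_disj [computable_intros]: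
  assumes "computable f" "computable g" shows "computable (\<lambda>c. f c \<or> g c)"
proof -
  have eq: "f c \<or> g c \<longleftrightarrow> (if f c then True else g c)" for c by simp
  show ?thesis unfolding eq by (intro computable_intros assms)
qed

lemma computable_Not [computable_intros]:
  assumes "computable f" shows "computable (\<lambda>c. \<not> f c)"
proof -
  have eq: "\<not> f c \<longleftrightarrow> (if f c then False else True)" for c by simp
  show ?thesis unfolding eq by (intro computable_intros assms)
qed

section \<open>Arithmetic and comparison of numbers\<close>

lemma computable_add [computable_intros]:
  "computable f \<Longrightarrow> computable g \<Longrightarrow> computable (\<lambda>c. f c + g c :: nat)"
proof -
  assume "computable f" "computable g"
  then have "computable (\<lambda>c. rec_nat (f c) (\<lambda>_ v. Suc v) (g c))" by (intro computable_intros)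
  moreover have "rec_nat x (\<lambda>_ v. Suc v) y = x + y" for x y by (induction y) auto
  ultimately show ?thesis by simp
qed

lemma computable_diff [computable_intros]:
  "computable f \<Longrightarrow> computable g \<Longrightarrow> computable (\<lambda>c. f c - g c :: nat)"
proof -
  assume "computable f" "computable g"
  then have "computable (\<lambda>c. rec_nat (f c) (\<lambda>_ v. case v of 0 \<Rightarrow> 0 | Suc w \<Rightarrow> w) (g c))"
    by (intro computable_intros)
  moreover have "rec_nat x (\<lambda>_ v. case v of 0 \<Rightarrow> 0 | Suc w \<Rightarrow> w) y = x - y" for x y :: nat
    by (induction y) (auto split: nat.splits)
  ultimately show ?thesis by simp
qed

text \<open>Injectivity of \<open>enc\<close> turns equality into equality of numbers, which holds
  when both truncated differences vanish.\<close>

lemma computable_eq [computable_intros]: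
  assumes "computable f" "computable g" shows "computable (\<lambda>c. f c = g c)"
proof -
  have "computable (\<lambda>c. case (enc (f c) - enc (g c)) + (enc (g c) - enc (f c)) of 0 \<Rightarrow> True | Suc _ \<Rightarrow> False)"
    by (intro computable_intros computable_enc_eq[of enc] assms) simp_all
  moreover have "(case (x - y) + (y - x) of 0 \<Rightarrow> True | Suc _ \<Rightarrow> False) \<longleftrightarrow> x = y" for x y :: nat
    by (auto split: nat.splits)
  ultimately show ?thesis by simp
qed

lemma computable_less [computable_intros]:
  assumes "computable f" "computable g" shows "computable (\<lambda>c. f c < (g c :: nat))"
proof -
  have "computable (\<lambda>c. g c - f c \<noteq> 0)" by (intro computable_intros assms)
  moreover have "g c - f c \<noteq> 0 \<longleftrightarrow> f c < g c" for c by auto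
  ultimately show ?thesis by simp
qed

section \<open>Lists\<close>

lemma computable_Cons [computable_intros]:
  assumes "computable f" "computable g" shows "computable (\<lambda>c. f c # g c)"
proof -
  obtain p :: "nat \<Rightarrow> nat" where p: "computable p" "\<And>x. p (enc x) = enc (f x)"
    by (rule computableE[OF assms(1)]) blast
  obtain q :: "nat \<Rightarrow> nat" where q: "computable q" "\<And>x. q (enc x) = enc (g x)"
    by (rule computableE[OF assms(2)]) blast
  show ?thesis
    by (rule computableI[of "\<lambda>n. Suc (prod_encode (p n, q n))"])
      (intro computable_intros p q, simp add: p(2) q(2))
qed

lemma computable_case_list [computable_intros]:
  assumes "computable xs" "computable a" "computable (\<lambda>z. f (fst z) (fst (snd z)) (snd (snd z)))"
  shows "computable (\<lambda>c. case xs c of [] \<Rightarrow> a c | y # ys \<Rightarrow> f c y ys)"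
proof -
  obtain pa :: "nat \<Rightarrow> nat" where a: "computable pa" "\<And>x. pa (enc x) = enc (a x)"
    by (rule computableE[OF assms(2)]) blast
  obtain pf :: "nat \<Rightarrow> nat"
    where f: "computable pf" "\<And>z. pf (enc z) = enc (f (fst z) (fst (snd z)) (snd (snd z)))"
    by (rule computableE[OF assms(3)]) blast
  obtain px :: "nat \<Rightarrow> nat" where x: "computable px" "\<And>x. px (enc x) = enc (xs x)"
    by (rule computableE[OF assms(1)]) blast
  show ?thesis
  proof (rule computableI)
    \<comment> \<open>The code of a non-empty list is the successor of the code of the pair of head
      and tail, so \<open>px n - 1\<close> is already the argument that \<open>pf\<close>
      expects.\<close>
    show "computable (\<lambda>n. if px n = 0 then pa n else pf (prod_encode (n, px n - 1)))"
      by (intro computable_intros computable_comp[OF f(1)] a x)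
    show "(if px (enc c) = 0 then pa (enc c) else pf (prod_encode (enc c, px (enc c) - 1))) =
        enc (case xs c of [] \<Rightarrow> a c | y # ys \<Rightarrow> f c y ys)" for c
      using a(2)[of c] x(2)[of c] f(2)[of "(c, hd (xs c), tl (xs c))"]
      by (cases "xs c") auto
  qed
qed

text \<open>The depth of a primitive recursion must be known in advance. The code of a list is at
  least its length, so the loop runs that many times, and rounds after the list is exhausted leave
  the state alone.\<close>

lemma computable_fold [computable_intros]:
  fixes xs :: "'a::encodable \<Rightarrow> 'b::encodable list" and a :: "'a \<Rightarrow> 'c::encodable"
  assumes "computable (\<lambda>z. f (fst z) (fst (snd z)) (snd (snd z)))" "computable xs" "computable a"
  shows "computable (\<lambda>c. fold (f c) (xs c) (a c))"
proof -
  let ?step = "\<lambda>c s. case fst s of [] \<Rightarrow> s | y # ys \<Rightarrow> (ys, f c y (snd s))"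
  have "computable (\<lambda>c. snd (rec_nat (xs c, a c) (\<lambda>_ s. ?step c s) (enc (xs c))))"
    using computable_comp[OF assms(1), of "\<lambda>z. (fst (fst z), fst (snd z), snd (snd (snd (fst z))))"]
    by (intro computable_intros assms computable_enc_eq[of enc]) (simp_all add: computable_intros)
  moreover have "rec_nat (ys, b) (\<lambda>_ s. ?step c s) k = ([], fold (f c) ys b)" if "length ys \<le> k" for c ys b and k :: nat
  proof -
    have "rec_nat (ys, b) (\<lambda>_ s. ?step c s) k = (drop k ys, fold (f c) (take k ys) b)"
    proof (induction k)
      case (Suc k)
      then show ?case
        by (cases "k < length ys")
          (auto simp: take_Suc_conv_app_nth Cons_nth_drop_Suc[symmetric] simp del: drop_Suc)
    qed auto
    then show ?thesis using that by simp
  qed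
  moreover have "length ys \<le> enc ys" for ys :: "'b list"
  proof (induction ys)
    case (Cons y ys)
    then show ?case using le_prod_encode_2[of "list_encode (map enc ys)" "enc y"] by auto
  qed auto
  ultimately show ?thesis by (simp del: enc_list_def)
qed

lemma computable_rev [computable_intros]: "computable f \<Longrightarrow> computable (\<lambda>c. rev (f c))"
  unfolding rev_conv_fold by (intro computable_intros)

lemma computable_foldr [computable_intros]:
  assumes "computable (\<lambda>z. f (fst z) (fst (snd z)) (snd (snd z)))" "computable xs" "computable a"
  shows "computable (\<lambda>c. foldr (f c) (xs c) (a c))"
  unfolding foldr_conv_fold by (intro computable_intros assms)

lemma computable_append [computable_intros]:
  fixes f :: "_ \<Rightarrow> 'a::encodable list"
  shows "computable f \<Longrightarrow> computable g \<Longrightarrow> computable (\<lambda>c. f c @ g c)"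
proof -
  assume fg: "computable f" "computable g"
  have eq: "us @ vs = foldr (#) us vs" for us vs :: "'a list" by (induction us) auto
  show ?thesis unfolding eq by (intro computable_intros fg)
qed

lemma computable_map [computable_intros]:
  assumes "computable (\<lambda>z. f (fst z) (snd z))" "computable xs"
  shows "computable (\<lambda>c. map (f c) (xs c))"
proof -
  have "computable (\<lambda>c. foldr (\<lambda>x ys. f c x # ys) (xs c) [])"
    using computable_comp[OF assms(1), of "\<lambda>z. (fst z, fst (snd z))"]
    by (intro computable_intros assms) (simp add: computable_intros)
  moreover have "foldr (\<lambda>x ys. h x # ys) zs [] = map h zs" for h :: "'b \<Rightarrow> 'c" and zs by (induction zs) auto
  ultimately show ?thesis by simp
qed

lemma computable_filter [computable_intros]:
  assumes "computable (\<lambda>z. f (fst z) (snd z))" "computable xs"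
  shows "computable (\<lambda>c. filter (f c) (xs c))"
proof -
  have "computable (\<lambda>c. foldr (\<lambda>x ys. if f c x then x # ys else ys) (xs c) [])"
    using computable_comp[OF assms(1), of "\<lambda>z. (fst z, fst (snd z))"]
    by (intro computable_intros assms) (simp add: computable_intros)
  moreover have "foldr (\<lambda>x ys. if h x then x # ys else ys) zs [] = filter h zs" for h and zs :: "'b list"
    by (induction zs) auto
  ultimately show ?thesis by simp
qed

lemma computable_list_all [computable_intros]:
  assumes "computable (\<lambda>z. f (fst z) (snd z))" "computable xs"
  shows "computable (\<lambda>c. list_all (f c) (xs c))"
proof -
  have "computable (\<lambda>c. filter (\<lambda>x. \<not> f c x) (xs c) = [])"
    by (intro computable_intros assms)
  then show ?thesis by (simp add: filter_empty_conv list_all_iff)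
qed

lemma computable_length [computable_intros]:
  assumes "computable xs" shows "computable (\<lambda>c. length (xs c))"
proof -
  have "computable (\<lambda>c. foldr (\<lambda>_ n. Suc n) (xs c) 0)" by (intro computable_intros assms)
  moreover have "foldr (\<lambda>_ n. Suc n) zs 0 = length zs" for zs :: "'b list" by (induction zs) auto
  ultimately show ?thesis by simp
qed

lemma computable_distinct [computable_intros]:
  assumes "computable xs" shows "computable (\<lambda>c. distinct (xs c))"
proof -
  have "computable (\<lambda>c. snd (foldr (\<lambda>x s. (x # fst s, list_all (\<lambda>y. y \<noteq> x) (fst s) \<and> snd s)) (xs c) ([], True)))"
    by (intro computable_intros assms)
  moreover have "foldr (\<lambda>x s. (x # fst s, list_all (\<lambda>y. y \<noteq> x) (fst s) \<and> snd s)) zs ([], True) = (zs, distinct zs)"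
    for zs :: "'b list" by (induction zs) (auto simp: list_all_iff)
  ultimately show ?thesis by simp
qed

lemma computable_drop [computable_intros]:
  assumes "computable k" "computable xs" shows "computable (\<lambda>c. drop (k c) (xs c))"
proof -
  have "computable (\<lambda>c. rec_nat (xs c) (\<lambda>_ ys. case ys of [] \<Rightarrow> [] | z # zs \<Rightarrow> zs) (k c))"
    by (intro computable_intros assms)
  moreover have "rec_nat zs (\<lambda>_ ys. case ys of [] \<Rightarrow> [] | z # zs \<Rightarrow> zs) n = drop n zs"
    for n and zs :: "'b list"
    by (induction n) (auto simp: drop_Suc drop_tl split: list.splits)
  ultimately show ?thesis by simp
qed

lemma computable_take [computable_intros]:
  assumes "computable k" "computable xs" shows "computable (\<lambda>c. take (k c) (xs c))"
proof -
  have "computable (\<lambda>c. rev (drop (length (xs c) - k c) (rev (xs c))))"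
    by (intro computable_intros assms)
  moreover have "rev (drop (length ys - n) (rev ys)) = take n ys" for n and ys :: "'b list"
    by (metis rev_drop rev_rev_ident take_all_iff diff_diff_cancel nle_le diff_is_0_eq length_rev diff_zero)
  ultimately show ?thesis by simp
qed

lemma computable_zip [computable_intros]:
  assumes "computable xs" "computable ys" shows "computable (\<lambda>c. zip (xs c) (ys c))"
proof -
  let ?f = "\<lambda>x s. case fst s of [] \<Rightarrow> s | y # ys \<Rightarrow> (ys, (x, y) # snd s)"
  have "computable (\<lambda>c. rev (snd (fold ?f (xs c) (ys c, []))))"
    by (intro computable_intros assms)
  moreover have "rev (snd (fold ?f us (vs, ws))) = rev ws @ zip us vs"
    for us :: "'b list" and vs :: "'c list" and ws
  proof (induction us arbitrary: vs ws)
    case (Cons u us) then show ?case by (cases vs) auto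
  qed auto
  ultimately show ?thesis by simp
qed

section \<open>Disjoint sums and integers\<close>

lemma computable_Inl [computable_intros]:
  fixes f :: "'a::encodable \<Rightarrow> 'b::encodable"
  assumes "computable f" shows "computable (\<lambda>c. Inl (f c) :: 'b + 'c::encodable)"
proof -
  have "computable (\<lambda>n::nat. n + n)" by (intro computable_intros)
  then have "computable (Inl :: 'b \<Rightarrow> 'b + 'c)" by (rule computableI) (simp add: sum_encode_def)
  from computable_comp[OF this assms] show ?thesis .
qed

lemma computable_Inr [computable_intros]:
  fixes f :: "'a::encodable \<Rightarrow> 'b::encodable"
  assumes "computable f" shows "computable (\<lambda>c. Inr (f c) :: 'c::encodable + 'b)"
proof -
  have "computable (\<lambda>n::nat. Suc (n + n))" by (intro computable_intros)
  then have "computable (Inr :: 'b \<Rightarrow> 'c + 'b)" by (rule computableI) (simp add: sum_encode_def)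
  from computable_comp[OF this assms] show ?thesis .
qed

text \<open>Left summands have even codes and right summands odd ones, so a case distinction needs
  parity and half. One recursion tracks both, toggling the parity at each step.\<close>

lemma computable_div2_even:
  "computable (\<lambda>n::nat. n div 2)" "computable (\<lambda>n::nat. even n)"
proof -
  let ?r = "\<lambda>n. rec_nat (0::nat, True) (\<lambda>_ s. if snd s then (fst s, False) else (Suc (fst s), True)) n"
  have r: "?r n = (n div 2, even n)" for n by (induction n) auto
  have "computable (\<lambda>n. fst (?r n))" "computable (\<lambda>n. snd (?r n))"
    by (intro computable_intros)+
  then show "computable (\<lambda>n::nat. n div 2)" "computable (\<lambda>n::nat. even n)" unfolding r by simp_all
qed

lemma computable_case_sum [computable_intros]:
  assumes "computable s" "computable (\<lambda>z. f (fst z) (snd z))" "computable (\<lambda>z. g (fst z) (snd z))"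
  shows "computable (\<lambda>c. case s c of Inl x \<Rightarrow> f c x | Inr y \<Rightarrow> g c y)"
proof -
  obtain pf :: "nat \<Rightarrow> nat" where f: "computable pf" "\<And>z. pf (enc z) = enc (f (fst z) (snd z))"
    by (rule computableE[OF assms(2)]) blast
  obtain pg :: "nat \<Rightarrow> nat" where g: "computable pg" "\<And>z. pg (enc z) = enc (g (fst z) (snd z))"
    by (rule computableE[OF assms(3)]) blast
  obtain ps :: "nat \<Rightarrow> nat" where s: "computable ps" "\<And>x. ps (enc x) = enc (s x)"
    by (rule computableE[OF assms(1)]) blast
  show ?thesis
  proof (rule computableI)
    show "computable (\<lambda>n. if even (ps n) then pf (prod_encode (n, ps n div 2))
                           else pg (prod_encode (n, ps n div 2)))"
      by (intro computable_intros computable_comp[OF f(1)] computable_comp[OF g(1)]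
          computable_comp[OF computable_div2_even(1)] computable_comp[OF computable_div2_even(2)] s)
    show "(if even (ps (enc c)) then pf (prod_encode (enc c, ps (enc c) div 2))
           else pg (prod_encode (enc c, ps (enc c) div 2))) =
        enc (case s c of Inl x \<Rightarrow> f c x | Inr y \<Rightarrow> g c y)" for c
      using s(2)[of c] f(2)[of "(c, projl (s c))"] g(2)[of "(c, projr (s c))"]
      by (cases "s c") (auto simp: sum_encode_def)
  qed
qed

text \<open>\<open>int_encode\<close> is \<open>sum_encode\<close> after a split by sign, so the
  conversions preserve codes and integer arithmetic reduces to arithmetic on naturals. The shift by
  one on the negative side avoids a second zero.\<close>

definition int_of_sum :: "nat + nat \<Rightarrow> int" where
  "int_of_sum s = (case s of Inl a \<Rightarrow> int a | Inr b \<Rightarrow> - int b - 1)"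

definition sum_of_int :: "int \<Rightarrow> nat + nat" where
  "sum_of_int i = (if 0 \<le> i then Inl (nat i) else Inr (nat (- i - 1)))"

lemma computable_int_of_sum: "computable f \<Longrightarrow> computable (\<lambda>c. int_of_sum (f c))"
  by (rule computable_enc_eq)
    (auto simp: int_of_sum_def enc_int_def int_encode_def split: sum.splits)

lemma computable_sum_of_int: "computable f \<Longrightarrow> computable (\<lambda>c. sum_of_int (f c))"
  by (rule computable_enc_eq) (auto simp: sum_of_int_def enc_int_def int_encode_def)

lemma computable_uminus_int [computable_intros]:
  assumes "computable f" shows "computable (\<lambda>c. - f c :: int)"
proof -
  have "computable (\<lambda>c. int_of_sum (case sum_of_int (f c) of
      Inl a \<Rightarrow> (case a of 0 \<Rightarrow> Inl 0 | Suc b \<Rightarrow> Inr b) | Inr b \<Rightarrow> Inl (Suc b)))"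
    by (intro computable_intros computable_int_of_sum computable_sum_of_int assms)
  moreover have "int_of_sum (case sum_of_int i of
      Inl a \<Rightarrow> (case a of 0 \<Rightarrow> Inl 0 | Suc b \<Rightarrow> Inr b) | Inr b \<Rightarrow> Inl (Suc b)) = - i" for i
    by (auto simp: int_of_sum_def sum_of_int_def split: nat.splits)
  ultimately show ?thesis by simp
qed

lemma computable_add_int [computable_intros]:
  assumes "computable f" "computable g" shows "computable (\<lambda>c. f c + g c :: int)"
proof -
  let ?add = "\<lambda>s t. case s of
      Inl a \<Rightarrow> (case t of Inl b \<Rightarrow> Inl (a + b) | Inr b \<Rightarrow> if b < a then Inl (a - Suc b) else Inr (b - a))
    | Inr a \<Rightarrow> (case t of Inl b \<Rightarrow> if a < b then Inl (b - Suc a) else Inr (a - b) | Inr b \<Rightarrow> Inr (Suc (a + b)))"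
  have "computable (\<lambda>c. int_of_sum (?add (sum_of_int (f c)) (sum_of_int (g c))))"
    by (intro computable_intros computable_int_of_sum computable_sum_of_int assms
        computable_comp[OF assms(2)])
  moreover have "int_of_sum (?add (sum_of_int i) (sum_of_int j)) = i + j" for i j
    by (auto simp: int_of_sum_def sum_of_int_def)
  ultimately show ?thesis by simp
qed

section \<open>Enumeration of candidates and unbounded search\<close>

lemma decoder_nat: "computable (\<lambda>n::nat. n)" "surj (\<lambda>n::nat. n)"
  by (auto intro: computable_intros)

lemma decoder_bool: "computable (\<lambda>n::nat. n \<noteq> 0)" "surj (\<lambda>n::nat. n \<noteq> 0)"
proof -
  show "surj (\<lambda>n::nat. n \<noteq> 0)" by (rule surjI[of _ of_bool]) simp
qed (intro computable_intros)

text \<open>The search asks of an enumeration only that it is computable and reaches every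
  candidate; repetitions, as in \<open>decoder_bool\<close>, do no harm.\<close>

lemma decoder_prod:
  assumes "computable d" "surj d" "computable d'" "surj d'"
  shows "computable (\<lambda>n. map_prod d d' (prod_decode n))" "surj (\<lambda>n. map_prod d d' (prod_decode n))"
proof -
  have "computable (\<lambda>n. (d (fst (prod_decode n)), d' (snd (prod_decode n))))"
    by (intro computable_intros computable_comp[OF assms(1)] computable_comp[OF assms(3)]
        computable_enc_eq[of prod_decode]) (simp_all only: enc_prod_def enc_nat_def prod.collapse prod_decode_inverse)
  then show "computable (\<lambda>n. map_prod d d' (prod_decode n))"
    by (simp add: map_prod_def case_prod_unfold)
  show "surj (\<lambda>n. map_prod d d' (prod_decode n))"
    by (rule surjI[of _ "\<lambda>y. prod_encode (map_prod (inv_into UNIV d) (inv_into UNIV d') y)"])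
      (auto simp: surj_f_inv_f[OF assms(2)] surj_f_inv_f[OF assms(4)])
qed

lemma decoder_list:
  assumes "computable d" "surj d"
  shows "computable (\<lambda>n. map d (list_decode n))" "surj (\<lambda>n. map d (list_decode n))"
proof -
  show "computable (\<lambda>n. map d (list_decode n))"
    by (intro computable_intros computable_comp[OF assms(1)] computable_enc_eq[of list_decode])
       (simp_all add: enc_nat_def[abs_def] list.map_ident)
  show "surj (\<lambda>n. map d (list_decode n))"
    by (rule surjI[of _ "\<lambda>y. list_encode (map (inv_into UNIV d) y)"])
      (simp add: surj_f_inv_f[OF assms(2)] comp_def)
qed

text \<open>Minimisation finds the first index whose candidate satisfies \<open>P\<close>, and
  \<open>out\<close> is evaluated at that candidate. The algorithm is fixed before the input
  \<open>x\<close>, and nothing is claimed about inputs without a candidate.\<close>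

lemma partial_recursive_search:
  fixes P :: "'i::encodable \<Rightarrow> 'k::encodable \<Rightarrow> bool" and out :: "'i \<Rightarrow> 'k \<Rightarrow> 'o::encodable"
  assumes P: "computable (\<lambda>z. P (fst z) (snd z))" and out: "computable (\<lambda>z. out (fst z) (snd z))"
    and d: "computable (d :: nat \<Rightarrow> 'k)" "surj d"
  shows "\<exists>alg. partial_recursive alg \<and>
    (\<forall>x. (\<exists>k. P x k) \<longrightarrow> (\<exists>k. P x k \<and> alg (enc x) = Some (enc (out x k))))"
proof -
  have dz: "computable (\<lambda>z. d (snd z))" by (intro computable_comp[OF d(1)] computable_intros)
  have "computable (\<lambda>z. if P (fst z) (d (snd z)) then 0 else 1 :: nat)"
    using computable_comp[OF P computable_Pair[OF computable_fst[OF computable_id] dz]]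
    by (intro computable_intros) simp
  then obtain p where p: "partial_recursive (\<lambda>n. Some (p n))"
      and "\<forall>z. p (enc z) = enc (if P (fst z) (d (snd z)) then 0 else 1 :: nat)"
    unfolding computable_def total_recursive_def by blast
  then have p2: "p (prod_encode (enc x, k)) = (if P x (d k) then 0 else 1)" for x k
    using spec[of _ "(x, k)"] by fastforce
  have "computable (\<lambda>z. out (fst z) (d (snd z)))"
    using computable_comp[OF out computable_Pair[OF computable_fst[OF computable_id] dz]] by simp
  then obtain q where q: "partial_recursive (\<lambda>n. Some (q n))"
      and "\<forall>z. q (enc z) = enc (out (fst z) (d (snd z)))"
    unfolding computable_def total_recursive_def by blast
  then have q2: "q (prod_encode (enc x, k)) = enc (out x (d k))" for x k
    using spec[of _ "(x, k)"] by fastforce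
  let ?s = "\<lambda>a. if \<exists>k. p (prod_encode (a, k)) = 0 then Some (LEAST k. p (prod_encode (a, k)) = 0) else None"
  \<comment> \<open>The side condition of \<open>minimize\<close>, definedness at smaller arguments,
    is automatic because \<open>p\<close> is total.\<close>
  have s: "partial_recursive ?s"
    using partial_recursive.minimize[OF p] by (simp cong: if_cong)
  let ?alg = "\<lambda>n. Option.bind (Option.bind (?s n) (\<lambda>b. Some (prod_encode (n, b)))) (\<lambda>n. Some (q n))"
  have "partial_recursive (\<lambda>n. Option.bind (Some n) (\<lambda>a. Option.bind (?s n) (\<lambda>b. Some (prod_encode (a, b)))))"
    using partial_recursive.pair[OF total_recursive_id[unfolded total_recursive_def] s] .
  then have "partial_recursive ?alg" using partial_recursive.comp[OF q] by (simp only: bind.bind_lunit)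
  moreover have "\<exists>k. P x k \<and> ?alg (enc x) = Some (enc (out x k))" if "P x k" for x k
  proof -
    obtain j where "d j = k" using d(2) by (metis surjD)
    then have ex: "\<exists>j. p (prod_encode (enc x, j)) = 0" using that p2 by (metis)
    then have "P x (d (LEAST j. p (prod_encode (enc x, j)) = 0))"
      using LeastI_ex[OF ex] p2 by (auto split: if_splits)
    then show ?thesis using ex q2 by auto
  qed
  ultimately show ?thesis by blast
qed

section \<open>Reduced words\<close>

abbreviation word_mult :: "'a word \<Rightarrow> 'a word \<Rightarrow> 'a word" where
  "word_mult \<equiv> foldr push_letter"

definition inv_word :: "'a word \<Rightarrow> 'a word" where
  "inv_word w = rev (map inv_letter w)"

lemma inv_word_simps [simp]:
  "inv_word [] = []" "inv_word (s # w) = inv_word w @ [inv_letter s]"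
  "inv_word (u @ v) = inv_word v @ inv_word u" "inv_word (inv_word w) = w"
  "length (inv_word w) = length w" "inv_word w = [] \<longleftrightarrow> w = []"
  by (simp_all add: inv_word_def rev_map comp_def)

lemma inv_word_eq_iff: "inv_word u = v \<longleftrightarrow> u = inv_word v"
  by auto

lemma inv_word_inject [simp]: "inv_word u = inv_word v \<longleftrightarrow> u = v"
  by (metis inv_word_simps(4))

lemma inv_word_closed_iff: "inv_word w \<in> S \<union> inv_word ` S \<longleftrightarrow> w \<in> S \<union> inv_word ` S"
  by (metis (no_types, lifting) Un_iff image_iff inv_word_simps(4))

lemma set_inv_word: "set (inv_word w) = inv_letter ` set w"
  by (simp add: inv_word_def)

lemma letters_inv_word [simp]: "letters (inv_word w) = letters w"
  by (force simp: letters_def set_inv_word)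

lemma inv_letter_neq [simp]: "inv_letter s \<noteq> s" "s \<noteq> inv_letter s"
  by (cases s; simp add: inv_letter_def)+

lemma inv_letter_inject [simp]: "inv_letter s = inv_letter t \<longleftrightarrow> s = t"
  by (metis inv_letter_inv_letter)

lemma reduced_append:
  "reduced (u @ v) \<longleftrightarrow> reduced u \<and> reduced v \<and> (u = [] \<or> v = [] \<or> hd v \<noteq> inv_letter (last u))"
  by (auto simp: reduced_def successively_append_iff)

lemma reduced_glue: "reduced (u @ [s]) \<Longrightarrow> reduced (s # v) \<Longrightarrow> reduced (u @ s # v)"
  by (auto simp: reduced_append)

lemma reduced_inv_word [simp]: "reduced (inv_word w) \<longleftrightarrow> reduced w"
proof -
  have "reduced (inv_word w)" if "reduced w" for w :: "'a word"
    using that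
  proof (induction w)
    case (Cons s w)
    then show ?case
      by (cases w) (auto simp: reduced_append reduced_Cons)
  qed auto
  from this[of w] this[of "inv_word w"] show ?thesis by auto
qed

lemma word_mult_reduced: "reduced (u @ v) \<Longrightarrow> word_mult u v = u @ v"
proof (induction u)
  case (Cons s u)
  then have "reduced (u @ v)" by (simp add: reduced_Cons)
  with Cons push_letter_reduced[of s "u @ v"] show ?case by simp
qed auto

lemma word_mult_cancel: "word_mult (a @ z) (inv_word z @ b) = word_mult a b"
proof (induction z rule: rev_induct)
  case (snoc s z)
  have "word_mult (a @ z @ [s]) (inv_word (z @ [s]) @ b) =
        word_mult (a @ z) (push_letter s (inv_letter s # inv_word z @ b))" by simp
  with snoc show ?case by simp
qed auto

lemma word_mult_inv_right: "word_mult w (inv_word w) = []"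
  using word_mult_cancel[of "[]" w "[]"] by simp

text \<open>Letters are peeled off the end of \<open>x\<close> as long as they are inverse to the
  first letter of what remains of \<open>y\<close>. The peeled part is \<open>z\<close>, and
  \<open>a @ b\<close> is reduced because the peeling has stopped.\<close>

lemma cancellation:
  assumes "reduced x" "reduced y"
  obtains a z b where "x = a @ z" "y = inv_word z @ b" "reduced (a @ b)" "word_mult x y = a @ b"
proof -
  have "\<exists>a z b. x = a @ z \<and> y = inv_word z @ b \<and> reduced (a @ b)"
    using assms
  proof (induction x arbitrary: y rule: rev_induct)
    case (snoc s x)
    show ?case
    proof (cases "y \<noteq> [] \<and> hd y = inv_letter s")
      case True
      then obtain y' where y: "y = inv_letter s # y'" by (cases y) auto
      with snoc.prems have "reduced x" "reduced y'" by (auto simp: reduced_append reduced_Cons)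
      then obtain a z b where "x = a @ z" "y' = inv_word z @ b" "reduced (a @ b)"
        using snoc.IH by blast
      then show ?thesis using y by (rule_tac x = a in exI, rule_tac x = "z @ [s]" in exI, rule_tac x = b in exI) simp
    next
      case False
      with snoc.prems show ?thesis
        by (rule_tac x = "x @ [s]" in exI, rule_tac x = "[]" in exI, rule_tac x = y in exI)
          (auto simp: reduced_append reduced_Cons)
    qed
  qed auto
  then show ?thesis using that by (metis word_mult_cancel word_mult_reduced)
qed

lemma word_mult_carrier:
  "reduced v \<Longrightarrow> reduced (word_mult u v)" "letters (word_mult u v) \<subseteq> letters u \<union> letters v"
  by (simp_all add: reduced_foldr letters_foldr)

lemma set_push_letter: "set (push_letter s w) \<subseteq> insert s (set w)"
  by (cases w) auto

lemma set_word_mult: "set (word_mult u v) \<subseteq> set u \<union> set v"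
  by (induction u) (use set_push_letter in fastforce)+

lemma free_group_simps [simp]:
  "monoid.mult (free_group A) = word_mult" "\<one>\<^bsub>free_group A\<^esub> = []"
  "w \<in> carrier (free_group A) \<longleftrightarrow> reduced w \<and> letters w \<subseteq> A"
  by (simp_all add: free_group_def)

lemma inv_free_group [simp]:
  assumes "w \<in> carrier (free_group A)"
  shows "inv\<^bsub>free_group A\<^esub> w = inv_word w"
  using assms group.inv_equality[OF group_free_group, where x = w and y = "inv_word w" and A1 = A]
    word_mult_inv_right[of "inv_word w"] by simp

text \<open>The last hypothesis says that the last \<open>k\<close> letters of \<open>u\<close> cancel against the first \<open>k\<close>
  letters of \<open>u\<close> in the product of \<open>u\<close> with itself.\<close>

lemma palindrome_bound:
  assumes "reduced u" "u \<noteq> []" "\<And>i. i < k \<Longrightarrow> u ! i = inv_letter (u ! (length u - 1 - i))"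
  shows "2 * k < length u"
proof (rule ccontr)
  assume k: "\<not> 2 * k < length u"
  have suc: "u ! Suc i \<noteq> inv_letter (u ! i)" if "Suc i < length u" for i
    using assms(1) that by (simp add: reduced_def successively_conv_nth)
  show False
  \<comment> \<open>At the middle the hypothesis contradicts reducedness: two adjacent letters would
    be inverse to each other, or a single middle letter would be its own inverse.\<close>
  proof (cases "even (length u)")
    case True
    then obtain h where h: "length u = 2 * h" by blast
    with assms(2) obtain i where i: "h = Suc i" by (cases h) auto
    then have "length u - 1 - i = Suc i" "i < k" "Suc i < length u" using h k by auto
    with assms(3)[of i] suc[of i] show False by (metis inv_letter_inv_letter)
  next
    case False
    then obtain h where h: "length u = 2 * h + 1" using oddE by blast
    then have "length u - 1 - h = h" "h < k" using k by auto
    with assms(3)[of h] show False by (metis inv_letter_neq(1))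
  qed
qed

lemma inv_word_nth: "i < length w \<Longrightarrow> inv_word w ! i = inv_letter (w ! (length w - 1 - i))"
  by (simp add: inv_word_def rev_nth)

lemma self_cancellation_bound:
  assumes "reduced u" "u \<noteq> []" "u = a @ z" "u = inv_word z @ b"
  shows "2 * length z < length u"
proof (rule palindrome_bound[OF assms(1,2)])
  fix i assume i: "i < length z"
  then have "u ! i = inv_letter (z ! (length z - 1 - i))"
    by (subst assms(4)) (simp add: nth_append inv_word_nth)
  moreover have "u ! (length u - 1 - i) = z ! (length z - 1 - i)"
  proof -
    have "length u - 1 - i = length a + (length z - 1 - i)" using i by (simp add: assms(3))
    then show ?thesis by (simp only: assms(3) nth_append_length_plus)
  qed
  ultimately show "u ! i = inv_letter (u ! (length u - 1 - i))" by simp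
qed

text \<open>A word equal to its inverse would cancel completely against itself, far beyond half of
  its length.\<close>

lemma inv_word_neq: "reduced u \<Longrightarrow> u \<noteq> [] \<Longrightarrow> inv_word u \<noteq> u"
  using self_cancellation_bound[of u "[]" u "[]"] by auto

section \<open>Marked words\<close>

text \<open>A factorisation \<open>(p, s, q)\<close> of the word \<open>p @ s # q\<close> marks its letter \<open>s\<close>. A list of factorised
  words is marked if no marked letter is cancelled in any product of two of the words or their
  inverses, inverse pairs excepted. The marked letters then survive in all reduced products.\<close>

type_synonym 'a factorisation = "'a word \<times> ('a \<times> bool) \<times> 'a word"

definition unmark :: "'a factorisation \<Rightarrow> 'a word" where
  "unmark t = (case t of (p, s, q) \<Rightarrow> p @ s # q)"

definition inv_fac :: "'a factorisation \<Rightarrow> 'a factorisation" where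
  "inv_fac t = (case t of (p, s, q) \<Rightarrow> (inv_word q, inv_letter s, inv_word p))"

text \<open>In the product of the two words, \<open>word_mult q p'\<close> is what remains between
  the marks. If it is empty, the condition says that the marked letters do not cancel each
  other.\<close>

definition compatible :: "'a factorisation \<Rightarrow> 'a factorisation \<Rightarrow> bool" where
  "compatible t t' = (case t of (p, s, q) \<Rightarrow> case t' of (p', s', q') \<Rightarrow>
     reduced (s # word_mult q p' @ [s']))"

definition marked :: "'a factorisation list \<Rightarrow> bool" where
  "marked ts = (distinct (map unmark (ts @ map inv_fac ts)) \<and>
     list_all (\<lambda>t. list_all (\<lambda>t'. t' = inv_fac t \<or> compatible t t') (ts @ map inv_fac ts))
       (ts @ map inv_fac ts))"

definition mark_at :: "'a word list \<Rightarrow> nat list \<Rightarrow> 'a factorisation list" where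
  "mark_at us ms = foldr (\<lambda>t ts. case t of (u, k) \<Rightarrow>
       (case drop k u of [] \<Rightarrow> ts | s # q \<Rightarrow> (take k u, s, q) # ts))
     (zip us ms) []"

text \<open>A position beyond the end of its word, or a missing position, makes
  \<open>mark_at\<close> lose that word; the second conjunct rejects such data. Marks are given as
  positions so that the data found by the search mention no letters.\<close>

definition markable :: "'a word list \<Rightarrow> nat list \<Rightarrow> bool" where
  "markable us ms \<longleftrightarrow> marked (mark_at us ms) \<and> map unmark (mark_at us ms) = us"

lemma unmark_inv_fac [simp]: "unmark (inv_fac t) = inv_word (unmark t)"
  by (cases t) (simp add: unmark_def inv_fac_def)

lemma inv_fac_inv_fac [simp]: "inv_fac (inv_fac t) = t"
  by (cases t) (simp add: inv_fac_def)

definition signed_fac :: "'a factorisation list \<Rightarrow> 'a word \<times> bool \<Rightarrow> 'a factorisation" where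
  "signed_fac ts x = (let t = SOME t. t \<in> set ts \<and> unmark t = fst x in if snd x then t else inv_fac t)"

lemma signed_fac:
  assumes "fst x \<in> unmark ` set ts"
  shows "unmark (signed_fac ts x) = (if snd x then fst x else inv_word (fst x))"
    "signed_fac ts x \<in> set (ts @ map inv_fac ts)"
proof -
  have "\<exists>t. t \<in> set ts \<and> unmark t = fst x" using assms by (metis imageE)
  from someI_ex[OF this] show "unmark (signed_fac ts x) = (if snd x then fst x else inv_word (fst x))"
    "signed_fac ts x \<in> set (ts @ map inv_fac ts)"
    by (auto simp: signed_fac_def Let_def)
qed

text \<open>Induction from the right. Cancellation between consecutive factors stops short of both
  marks, and by induction the value of the tail still begins with its first factor up to the mark.
  So the first factor keeps its prefix up to the mark, and the value is non-trivial.\<close>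

lemma marked_word_value:
  assumes m: "marked ts" and red: "\<And>t. t \<in> set ts \<Longrightarrow> unmark t \<in> carrier (free_group A)"
    and z: "reduced (x # z)" "letters (x # z) \<subseteq> unmark ` set ts"
  shows "\<exists>p s q r. signed_fac ts x = (p, s, q) \<and>
    word_value (free_group A) (x # z) = p @ s # r \<and> reduced (p @ s # r)"
  using z
proof (induction z arbitrary: x)
  case Nil
  then have x: "fst x \<in> unmark ` set ts" by simp
  then have c: "fst x \<in> carrier (free_group A)" using red by (metis imageE)
  obtain p s q where f: "signed_fac ts x = (p, s, q)" by (metis prod_cases3)
  have "word_value (free_group A) [x] = (if snd x then fst x else inv_word (fst x))"
    using c by (cases x) (auto simp: word_value_def word_mult_reduced)
  moreover have "reduced (if snd x then fst x else inv_word (fst x))" using c by auto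
  ultimately show ?case using signed_fac(1)[OF x] f
    by (auto simp: unmark_def intro!: exI[of _ q])
next
  case (Cons y z)
  have x: "fst x \<in> unmark ` set ts" and y: "fst y \<in> unmark ` set ts" using Cons.prems by auto
  have cx: "fst x \<in> carrier (free_group A)" using x red by (metis imageE)
  have xy: "y \<noteq> inv_letter x" "reduced (y # z)" using Cons.prems by (auto simp: reduced_Cons)
  then obtain p' s' q' r where y': "signed_fac ts y = (p', s', q')"
    "word_value (free_group A) (y # z) = p' @ s' # r" "reduced (p' @ s' # r)"
    using Cons.IH[of y] Cons.prems by auto
  obtain p s q where f: "signed_fac ts x = (p, s, q)" by (metis prod_cases3)
  have psq: "p @ s # q = (if snd x then fst x else inv_word (fst x))"
    using signed_fac(1)[OF x] f by (simp add: unmark_def)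
  \<comment> \<open>Were the two factors inverse, then, as no word occurs together with its inverse,
    they would be one word with opposite signs, against the reducedness of
    \<open>x # y # z\<close>.\<close>
  have "signed_fac ts y \<noteq> inv_fac (signed_fac ts x)"
  proof
    assume "signed_fac ts y = inv_fac (signed_fac ts x)"
    then have "unmark (signed_fac ts y) = inv_word (unmark (signed_fac ts x))" by simp
    then have eq: "(if snd y then fst y else inv_word (fst y)) =
        inv_word (if snd x then fst x else inv_word (fst x))"
      using signed_fac(1)[OF x] signed_fac(1)[OF y] by simp
    have "inv_word (fst x) \<notin> unmark ` set ts"
      using m x unfolding marked_def by (force simp: image_iff)
    moreover have "fst x \<noteq> inv_word (fst y)" using calculation y by auto
    ultimately have "fst x = fst y" "snd y = (\<not> snd x)"
      using eq y by (auto split: if_splits)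
    with xy(1) show False by (cases x; cases y) (auto simp: inv_letter_def)
  qed
  then have "compatible (signed_fac ts x) (signed_fac ts y)"
    using m signed_fac(2)[OF x] signed_fac(2)[OF y] unfolding marked_def list_all_iff by blast
  then have good: "reduced (s # word_mult q p' @ [s'])" by (simp add: compatible_def f y')
  have red_x: "reduced (p @ s # q)" using cx by (simp add: psq)
  \<comment> \<open>Reduced words that overlap in one letter glue to a reduced word; this is used
    first at \<open>s'\<close> and then at \<open>s\<close>.\<close>
  have "reduced ((s # word_mult q p') @ s' # r)"
    using reduced_glue[of "s # word_mult q p'" s' r] good y'(3) by (simp add: reduced_append)
  then have R: "reduced (p @ s # word_mult q p' @ s' # r)"
    using reduced_glue[of p s "word_mult q p' @ s' # r"] red_x
    by (auto simp: reduced_append reduced_Cons)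
  have red: "reduced (s' # r)" "reduced p'" "reduced (p' @ s' # r)"
    using y'(3) by (auto simp: reduced_append)
  have "word_value (free_group A) (x # y # z) = word_mult (p @ s # q) (p' @ s' # r)"
    using y'(2) cx psq by (cases x) (auto simp: word_value_def)
  also have "p' @ s' # r = word_mult p' (s' # r)" using red(3) word_mult_reduced by metis
  also have "word_mult (p @ s # q) \<dots> = word_mult (p @ [s]) (word_mult q (word_mult p' (s' # r)))"
    by simp
  also have "word_mult q (word_mult p' (s' # r)) = word_mult (word_mult q p') (s' # r)"
    using foldr_push_assoc[OF red(1)] by metis
  also have "\<dots> = word_mult q p' @ s' # r"
    using R by (intro word_mult_reduced) (auto simp: reduced_append reduced_Cons)
  also have "word_mult (p @ [s]) \<dots> = (p @ [s]) @ word_mult q p' @ s' # r"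
    using R by (intro word_mult_reduced) simp
  finally show ?case using f R by auto
qed

section \<open>Nielsen reduction\<close>

definition signed :: "('b \<Rightarrow> 'b) \<Rightarrow> bool \<Rightarrow> 'b \<Rightarrow> 'b" where
  "signed v p x = (if p then x else v x)"

type_synonym nielsen_move = "nat \<times> nat \<times> bool \<times> bool"

text \<open>The operations are parameters because the same moves act on words, on normal forms of
  the free product and on pairs. Case distinctions on \<open>drop\<close> take the place of
  indexing, so that computability and transfer apply directly. A move with unsuitable indices is the
  identity, hence any list of moves is a legal candidate.\<close>

definition nielsen_move ::
  "('b \<Rightarrow> 'b \<Rightarrow> 'b) \<Rightarrow> ('b \<Rightarrow> 'b) \<Rightarrow> nielsen_move \<Rightarrow> 'b list \<Rightarrow> 'b list" where
  "nielsen_move m v c T = (case c of (i, j, p, q) \<Rightarrow>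
     if i = j then T else
     case drop i T of [] \<Rightarrow> T | x # Y \<Rightarrow>
     case drop j T of [] \<Rightarrow> T | y # _ \<Rightarrow> take i T @ m (signed v p x) (signed v q y) # Y)"

definition nielsen :: "('b \<Rightarrow> 'b \<Rightarrow> 'b) \<Rightarrow> ('b \<Rightarrow> 'b) \<Rightarrow> nielsen_move list \<Rightarrow> 'b list \<Rightarrow> 'b list" where
  "nielsen m v cs T = fold (nielsen_move m v) cs T"

lemma nielsen_move_eq:
  "nielsen_move m v (i, j, p, q) T = (if i \<noteq> j \<and> i < length T \<and> j < length T
     then T[i := m (signed v p (T ! i)) (signed v q (T ! j))] else T)"
proof (cases "i \<noteq> j \<and> i < length T \<and> j < length T")
  case True
  then have "drop i T = T ! i # drop (Suc i) T" "drop j T = T ! j # drop (Suc j) T"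
    by (simp_all add: Cons_nth_drop_Suc)
  with True show ?thesis by (auto simp: nielsen_move_def upd_conv_take_nth_drop)
qed (auto simp: nielsen_move_def split: list.splits)

text \<open>The cancelled segment \<open>z\<close> lies inside \<open>q\<close> and its inverse
  inside \<open>p'\<close>, so both marks belong to the reduced word \<open>a @ b\<close>.\<close>

lemma compatible_decomposition:
  assumes "p @ s # q = a @ z" "p' @ s' # q' = inv_word z @ b" "reduced (a @ b)"
    "length z \<le> length q" "length z \<le> length p'"
  shows "compatible (p, s, q) (p', s', q')"
proof -
  have "(p @ [s]) @ q = a @ z" using assms(1) by simp
  then obtain q1 where q: "q = q1 @ z" "a = p @ s # q1"
    using assms(4) by (auto simp: append_eq_append_conv2 Cons_eq_append_conv)
  obtain p1 where p': "p' = inv_word z @ p1" "b = p1 @ s' # q'"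
  proof
    have "take (length z) p' = inv_word z"
      using arg_cong[OF assms(2), of "take (length z)"] assms(5) by simp
    then show "p' = inv_word z @ drop (length z) p'" by (metis append_take_drop_id)
    then show "b = drop (length z) p' @ s' # q'" using assms(2)
      by (metis append.assoc same_append_eq)
  qed
  have "reduced (s # q1 @ p1 @ [s'])" "reduced (q1 @ p1)"
    using assms(3) reduced_append[of "p" "(s # q1 @ p1 @ [s']) @ q'"]
      reduced_append[of "s # q1 @ p1 @ [s']" q'] reduced_append[of "s # q1 @ p1" "[s']"]
    by (simp_all add: q p' reduced_Cons)
  then show ?thesis using word_mult_cancel[of "[]" z p1]
    by (simp add: compatible_def q p' word_mult_reduced)
qed

text \<open>The assumptions \<open>right\<close> and \<open>left\<close> treat a word of
  \<open>us\<close> as first and as second factor. If that factor is an inverse word, the whole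
  product is inverted, which exchanges the two assumptions. The inequalities say that a cancelled
  suffix begins after position \<open>mark u\<close> and a cancelled prefix ends before it.\<close>

lemma markableI:
  fixes us :: "'a word list" and mark :: "'a word \<Rightarrow> nat"
  assumes red: "\<And>u. u \<in> set us \<Longrightarrow> reduced u"
    and dist: "distinct (us @ map inv_word us)"
    and mark: "\<And>u. u \<in> set us \<Longrightarrow> mark u < length u"
    and right: "\<And>u a z b. u \<in> set us \<Longrightarrow> inv_word z @ b \<in> set us \<union> inv_word ` set us \<Longrightarrow>
      u = a @ z \<Longrightarrow> inv_word z @ b \<noteq> inv_word u \<Longrightarrow> reduced (a @ b) \<Longrightarrow> mark u + length z < length u"
    and left: "\<And>u a z b. u \<in> set us \<Longrightarrow> a @ z \<in> set us \<union> inv_word ` set us \<Longrightarrow>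
      u = inv_word z @ b \<Longrightarrow> a @ z \<noteq> inv_word u \<Longrightarrow> reduced (a @ b) \<Longrightarrow> length z \<le> mark u"
  shows "markable us (map mark us)"
proof -
  define fac where "fac u = (take (mark u) u, u ! mark u, drop (Suc (mark u)) u)" for u
  have fac: "mark_at us (map mark us) = map fac us"
    using mark
  proof (induction us)
    case (Cons u us)
    then have "drop (mark u) u = u ! mark u # drop (Suc (mark u)) u"
      by (simp add: Cons_nth_drop_Suc)
    with Cons show ?case by (simp add: mark_at_def fac_def)
  qed (simp add: mark_at_def)
  have unmark_fac: "unmark (fac u) = u" if "u \<in> set us" for u
    using mark[OF that] by (simp add: unmark_def fac_def id_take_nth_drop[symmetric])
  then have map_unmark: "map unmark (map fac us) = us" by (simp add: map_idI)
  let ?D = "map fac us @ map inv_fac (map fac us)"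
  have right': "length z \<le> length q"
    if D: "(p, s, q) \<in> set ?D" and y: "inv_word z @ b \<in> set us \<union> inv_word ` set us"
      and eq: "p @ s # q = a @ z" "inv_word z @ b \<noteq> inv_word (p @ s # q)" and ab: "reduced (a @ b)"
    for p s q a z b
  proof -
    have len: "length p + Suc (length q) = length a + length z"
      using arg_cong[OF eq(1), of length] by simp
    consider u where "u \<in> set us" "(p, s, q) = fac u" | u where "u \<in> set us" "(p, s, q) = inv_fac (fac u)"
      using D by auto
    then show ?thesis
    proof cases
      case 1
      then have u: "u = p @ s # q" and "length p = mark u"
        using unmark_fac[of u] mark[of u] by (auto simp: unmark_def fac_def)
      with right[OF 1(1) y, of a] eq ab len show ?thesis by simp
    next
      case 2
      then have "fac u = (inv_word q, inv_letter s, inv_word p)"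
        by (metis inv_fac_inv_fac inv_fac_def case_prod_conv)
      then have u: "u = inv_word (p @ s # q)" and q: "length q = mark u"
        using unmark_fac[OF 2(1)] mark[OF 2(1)] by (auto simp: unmark_def fac_def dest: arg_cong[of _ _ length])
      have "inv_word b @ z \<in> set us \<union> inv_word ` set us"
        using y inv_word_closed_iff[of "inv_word b @ z"] by simp
      moreover have "inv_word b @ z \<noteq> inv_word u"
        using eq(2) unfolding u by (metis inv_word_simps(3,4))
      moreover have "reduced (inv_word b @ inv_word a)" using ab reduced_inv_word[of "a @ b"] by simp
      ultimately show ?thesis using left[OF 2(1), of "inv_word b" z "inv_word a"] eq(1) q u by simp
    qed
  qed
  have inv_D: "inv_fac t \<in> set ?D" if "t \<in> set ?D" for t
    using that by auto
  have left': "length z \<le> length p"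
    if D: "(p, s, q) \<in> set ?D" and y: "a @ z \<in> set us \<union> inv_word ` set us"
      and eq: "p @ s # q = inv_word z @ b" "a @ z \<noteq> inv_word (p @ s # q)" and ab: "reduced (a @ b)"
    for p s q a z b
  proof -
    have "length z \<le> length (inv_word p)"
    proof (rule right'[of "inv_word q" "inv_letter s" "inv_word p" z "inv_word a" "inv_word b"])
      show "(inv_word q, inv_letter s, inv_word p) \<in> set ?D"
        using inv_D[OF D] by (simp add: inv_fac_def)
      show "inv_word z @ inv_word a \<in> set us \<union> inv_word ` set us"
        using y inv_word_closed_iff[of "inv_word z @ inv_word a"] by simp
      show "inv_word q @ inv_letter s # inv_word p = inv_word b @ z"
        using arg_cong[OF eq(1), of inv_word] by simp
      show "inv_word z @ inv_word a \<noteq> inv_word (inv_word q @ inv_letter s # inv_word p)"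
        using eq(2) by (metis inv_word_simps append.assoc append_Cons append_Nil inv_letter_inv_letter)
      show "reduced (inv_word b @ inv_word a)" using ab reduced_inv_word[of "a @ b"] by simp
    qed
    then show ?thesis by simp
  qed
  have D_unmark: "unmark t \<in> set us \<union> inv_word ` set us" if "t \<in> set ?D" for t
    using that unmark_fac by auto
  have "t' = inv_fac t \<or> compatible t t'" if t: "t \<in> set ?D" "t' \<in> set ?D" for t t'
  proof (cases "unmark t' = inv_word (unmark t)")
    case True
    \<comment> \<open>No word of \<open>us\<close> has its inverse in \<open>us\<close>, and a word
      determines its factorisation; so factorisations of inverse words are inverse to each
      other.\<close>
    have no_inv: "inv_word u \<notin> set us" if "u \<in> set us" for u using dist that by auto
    from t consider u v where "t = fac u" "t' = fac v" "u \<in> set us" "v \<in> set us"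
      | u v where "t = fac u" "t' = inv_fac (fac v)" "u \<in> set us" "v \<in> set us"
      | u v where "t = inv_fac (fac u)" "t' = fac v" "u \<in> set us" "v \<in> set us"
      | u v where "t = inv_fac (fac u)" "t' = inv_fac (fac v)" "u \<in> set us" "v \<in> set us"
      by auto
    then show ?thesis
      by cases (use True no_inv unmark_fac in \<open>auto simp: inv_word_eq_iff\<close>)
  next
    case False
    obtain p s q where t1: "t = (p, s, q)" by (metis prod_cases3)
    obtain p' s' q' where t2: "t' = (p', s', q')" by (metis prod_cases3)
    have "reduced (unmark t)" "reduced (unmark t')"
      using D_unmark[OF t(1)] D_unmark[OF t(2)] red by auto
    then obtain a z b where d: "unmark t = a @ z" "unmark t' = inv_word z @ b" "reduced (a @ b)"
      by (metis cancellation)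
    have "length z \<le> length q" using right'[of p s q z b a] t D_unmark[OF t(2)] d False
      by (simp add: t1 unmark_def)
    moreover have "length z \<le> length p'" using left'[of p' s' q' a z b] t D_unmark[OF t(1)] d False
      by (simp add: t2 unmark_def inv_word_eq_iff) (metis inv_word_simps(4))
    ultimately show ?thesis using compatible_decomposition[of p s q a z p' s' q' b] d
      by (simp add: t1 t2 unmark_def)
  qed
  moreover have "distinct (map unmark ?D)"
  proof -
    have "map unmark (map inv_fac (map fac us)) = map inv_word us" using unmark_fac by simp
    then show ?thesis using dist map_unmark by (simp only: map_append)
  qed
  ultimately show ?thesis
    using map_unmark unfolding markable_def marked_def fac list_all_iff by blast
qed

lemma nielsen_simps [simp]:
  "nielsen m v [] T = T" "nielsen m v (c # cs) T = nielsen m v cs (nielsen_move m v c T)"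
  by (simp_all add: nielsen_def)

section \<open>The order on words and Nielsen reduced sets\<close>

definition half :: "'a list \<Rightarrow> 'a list" where
  "half w = take ((length w + 1) div 2) w"

text \<open>The numbering of the finitely many letters in use is auxiliary: it serves to show that a
  suitable list of moves exists and is invisible in the resulting marks.\<close>

locale letter_order =
  fixes B :: nat and \<kappa> :: "'a \<times> bool \<Rightarrow> nat" and \<Sigma> :: "('a \<times> bool) set"
  assumes inj: "inj_on \<kappa> \<Sigma>" and bound: "\<And>s. s \<in> \<Sigma> \<Longrightarrow> \<kappa> s < B" and B: "0 < B"
    and inv_closed: "inv_letter ` \<Sigma> \<subseteq> \<Sigma>"
begin

text \<open>Words of equal length are compared lexicographically, as numbers in base \<open>B\<close>.\<close>

definition val :: "'a word \<Rightarrow> nat" where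
  "val w = foldl (\<lambda>n s. B * n + \<kappa> s) 0 w"

text \<open>The classical order compares the initial halves of a word and of its inverse. Their sum
  is a natural number, hence a termination measure, and is symmetric under inversion. If two words
  share one of these halves, comparing the sums compares the others. The rounding in
  \<open>half\<close> puts the middle letter of a word of odd length into both.\<close>

definition weight :: "'a word \<Rightarrow> nat" where
  "weight w = val (half w) + val (half (inv_word w))"

lemma val_append: "val (u @ v) = val u * B ^ length v + val v"
proof (induction v rule: rev_induct)
  case (snoc s v)
  have snoc_val: "val (w @ [s]) = B * val w + \<kappa> s" for w s by (simp add: val_def)
  show ?case using snoc snoc_val[of "u @ v" s] snoc_val[of v s] by (simp add: algebra_simps)
qed (simp add: val_def)

lemma val_inject:
  "length u = length v \<Longrightarrow> set u \<subseteq> \<Sigma> \<Longrightarrow> set v \<subseteq> \<Sigma> \<Longrightarrow> val u = val v \<Longrightarrow> u = v"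
proof (induction u arbitrary: v rule: rev_induct)
  case (snoc s u)
  then obtain t v' where v: "v = v' @ [t]" by (cases v rule: rev_cases) auto
  have st: "\<kappa> s < B" "\<kappa> t < B" "s \<in> \<Sigma>" "t \<in> \<Sigma>" using snoc.prems v bound by auto
  have eq: "B * val u + \<kappa> s = B * val v' + \<kappa> t"
    using snoc.prems(4) v by (simp add: val_append) (simp add: val_def mult.commute)
  from arg_cong[OF eq, of "\<lambda>n. n mod B"] have "\<kappa> s = \<kappa> t" using st by simp
  moreover from this eq have "val u = val v'" using B by simp
  ultimately show ?case using snoc.IH[of v'] snoc.prems v st inj_onD[OF inj] by auto
qed auto

lemma val_append_le: "length u = length v \<Longrightarrow> val (u @ w) \<le> val (v @ w) \<Longrightarrow> val u \<le> val v"
  using B by (simp add: val_append)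

lemma weight_inv_word [simp]: "weight (inv_word w) = weight w"
  by (simp add: weight_def)

text \<open>Only the left factor is compared with the product; in a set closed under inversion the
  inverse product covers the right factor. The case \<open>y = x\<close> is left out because a move
  combines two different positions.\<close>

definition nielsen_reduced :: "'a word set \<Rightarrow> bool" where
  "nielsen_reduced S \<longleftrightarrow> (\<forall>x\<in>S. \<forall>y\<in>S. y \<noteq> x \<longrightarrow> y \<noteq> inv_word x \<longrightarrow>
     length x < length (word_mult x y) \<or>
     length x = length (word_mult x y) \<and> weight x \<le> weight (word_mult x y))"

lemma nielsen_reducedD:
  assumes "nielsen_reduced S" "x \<in> S" "y \<in> S" "y \<noteq> x" "y \<noteq> inv_word x"
  shows "length x < length (word_mult x y) \<or>
     length x = length (word_mult x y) \<and> weight x \<le> weight (word_mult x y)"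
  using assms unfolding nielsen_reduced_def by blast

context
  fixes us :: "'a word list" and S :: "'a word set"
  defines "S \<equiv> set us \<union> inv_word ` set us"
  assumes words: "\<And>u. u \<in> set us \<Longrightarrow> reduced u \<and> u \<noteq> [] \<and> set u \<subseteq> \<Sigma>"
    and N: "nielsen_reduced S"
begin

lemma S_words: "x \<in> S \<Longrightarrow> reduced x \<and> x \<noteq> [] \<and> set x \<subseteq> \<Sigma>"
proof -
  have "set (inv_word u) \<subseteq> \<Sigma>" if "set u \<subseteq> \<Sigma>" for u
    using image_mono[OF that, of inv_letter] inv_closed by (simp add: set_inv_word subset_trans)
  then show "x \<in> S \<Longrightarrow> reduced x \<and> x \<noteq> [] \<and> set x \<subseteq> \<Sigma>" using words by (auto simp: S_def)
qed

lemma S_inv: "inv_word x \<in> S \<longleftrightarrow> x \<in> S"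
  unfolding S_def by (rule inv_word_closed_iff)

lemma cancel_left_half:
  assumes "a @ z \<in> S" "inv_word z @ b \<in> S" "inv_word z @ b \<noteq> a @ z"
    "inv_word z @ b \<noteq> inv_word (a @ z)" "reduced (a @ b)"
  shows "length z \<le> length b"
proof -
  have "word_mult (a @ z) (inv_word z @ b) = a @ b"
    using assms(5) by (metis word_mult_cancel word_mult_reduced)
  with nielsen_reducedD[OF N assms(1-4)] show ?thesis by auto
qed

text \<open>For different words, \<open>nielsen_reduced\<close> and its mirror image under inversion
  give the bounds. For a word times itself they come from \<open>self_cancellation_bound\<close>,
  and there they are strict.\<close>

lemma cancellation_le_half:
  assumes "a @ z \<in> S" "inv_word z @ b \<in> S"
    "inv_word z @ b \<noteq> inv_word (a @ z)" "reduced (a @ b)"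
  shows "length z \<le> length a" "length z \<le> length b"
    "inv_word z @ b = a @ z \<Longrightarrow> length z < length a"
proof -
  have eq: "length z < length a \<and> length z < length b" if "inv_word z @ b = a @ z"
  proof -
    have "2 * length z < length (a @ z)"
      using self_cancellation_bound[OF _ _ refl that[symmetric]] S_words[OF assms(1)] by blast
    moreover have "length z + length b = length a + length z"
      using arg_cong[OF that, of length] by simp
    ultimately show ?thesis by simp
  qed
  then show "inv_word z @ b = a @ z \<Longrightarrow> length z < length a" by blast
  show "length z \<le> length b" using cancel_left_half[OF assms(1,2) _ assms(3,4)] eq by fastforce
  have "length z \<le> length (inv_word a)" if "inv_word z @ b \<noteq> a @ z"
  proof (rule cancel_left_half)
    show "inv_word b @ z \<in> S" using assms(2) S_inv[of "inv_word b @ z"] by simp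
    show "inv_word z @ inv_word a \<in> S" using assms(1) S_inv[of "a @ z"] by simp
    show "inv_word z @ inv_word a \<noteq> inv_word b @ z"
      using that inv_word_inject[of "inv_word z @ b" "a @ z"] by auto
    show "inv_word z @ inv_word a \<noteq> inv_word (inv_word b @ z)"
      using assms(3) inv_word_inject[of "inv_word z @ b" "inv_word (a @ z)"] by auto
    show "reduced (inv_word b @ inv_word a)" using assms(4) reduced_inv_word[of "a @ b"] by simp
  qed
  with eq show "length z \<le> length a" by fastforce
qed

text \<open>If \<open>u = b @ inv_word c\<close> cancels by half against \<open>z = c @ d\<close>, then comparing \<open>z\<close> with the
  product \<open>u z = b @ d\<close> of the same length orders the two halves of \<open>u\<close>.\<close>

lemma half_cancellation_val:
  assumes "b @ inv_word c \<in> S" "c @ d \<in> S" "length b = length c"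
    "c @ d \<noteq> b @ inv_word c" "c @ d \<noteq> inv_word (b @ inv_word c)" "reduced (b @ d)"
  shows "val c \<le> val b"
proof -
  \<comment> \<open>Since \<open>nielsen_reduced\<close> bounds left factors, the product is
    inverted: \<open>?x\<close> and \<open>?y\<close> are the inverses of \<open>c @ d\<close> and
    \<open>b @ inv_word c\<close>.\<close>
  let ?x = "inv_word d @ inv_word c" and ?y = "c @ inv_word b"
  have xy: "?x \<in> S" "?y \<in> S"
    using assms(1,2) S_inv[of "c @ d"] S_inv[of "b @ inv_word c"] by auto
  have mult: "word_mult ?x ?y = inv_word (b @ d)"
    using assms(6) reduced_inv_word[of "b @ d"] word_mult_cancel[of "inv_word d" "inv_word c" "inv_word b"]
      word_mult_reduced[of "inv_word d" "inv_word b"] by simp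
  have "?y \<noteq> ?x" using assms(4) inv_word_inject[of ?y ?x] by auto
  moreover have "?y \<noteq> inv_word ?x" using assms(5) by auto
  ultimately have "weight ?x \<le> weight (inv_word (b @ d))"
    using nielsen_reducedD[OF N xy, unfolded mult] assms(3) by auto
  then have "weight (c @ d) \<le> weight (b @ d)"
    using weight_inv_word[of "c @ d"] weight_inv_word[of "b @ d"] by simp
  moreover have "length c \<le> length d"
    using cancellation_le_half(2)[of b "inv_word c" d] assms by simp
  \<comment> \<open>As \<open>c\<close> is at most as long as \<open>d\<close>, the initial half of
    the inverse of \<open>c @ d\<close> lies within \<open>inv_word d\<close> and is shared with
    \<open>b @ d\<close>. The weights therefore differ only in the halves that begin with
    \<open>c\<close> and with \<open>b\<close>.\<close>
  then have "half (inv_word d @ inv_word c) = half (inv_word d @ inv_word b)"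
    "half (c @ d) = c @ take ((length c + length d + 1) div 2 - length c) d"
    "half (b @ d) = b @ take ((length c + length d + 1) div 2 - length c) d"
    using assms(3) by (auto simp: half_def)
  ultimately have "val (c @ take ((length c + length d + 1) div 2 - length c) d) \<le>
      val (b @ take ((length c + length d + 1) div 2 - length c) d)"
    by (simp add: weight_def)
  then show ?thesis using val_append_le assms(3) by metis
qed

text \<open>If the right half of \<open>b @ inv_word c\<close> cancels against one word and the left
  half against another, the two comparisons of values are opposite and force \<open>b = c\<close>.
  The word would then be its own inverse.\<close>

lemma no_double_half_cancellation:
  assumes "b @ inv_word c \<in> S" "c @ d \<in> S" "a @ inv_word b \<in> S" "length b = length c"
    "c @ d \<noteq> b @ inv_word c" "c @ d \<noteq> inv_word (b @ inv_word c)" "reduced (b @ d)"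
    "a @ inv_word b \<noteq> b @ inv_word c" "a @ inv_word b \<noteq> inv_word (b @ inv_word c)" "reduced (a @ inv_word c)"
  shows False
proof -
  have "val c \<le> val b" using half_cancellation_val[of b c d] assms by blast
  moreover have "val b \<le> val c"
  proof (rule half_cancellation_val)
    show "c @ inv_word b \<in> S" using assms(1) S_inv[of "b @ inv_word c"] by simp
    show "b @ inv_word a \<in> S" using assms(3) S_inv[of "a @ inv_word b"] by simp
    show "b @ inv_word a \<noteq> c @ inv_word b" using assms(8) by (metis inv_word_simps(3,4))
    show "b @ inv_word a \<noteq> inv_word (c @ inv_word b)" using assms(9) by (metis inv_word_simps(3,4))
    show "reduced (c @ inv_word a)" using assms(10) reduced_inv_word[of "a @ inv_word c"] by simp
  qed (use assms(4) in simp)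
  moreover have "set b \<subseteq> \<Sigma>" "set c \<subseteq> \<Sigma>" using S_words[OF assms(1)] S_words[OF assms(2)] by auto
  ultimately have "b = c" using val_inject assms(4) by simp
  then have "inv_word (b @ inv_word c) = b @ inv_word c" by simp
  then show False using inv_word_neq S_words[OF assms(1)] by blast
qed

text \<open>In a word of odd length the middle letter survives all cancellations. In even length a
  whole half may cancel, but only on one side: \<open>R u\<close> says that the right half does, and
  then the mark is the last letter of the left half; otherwise it is the first letter of the right
  half.\<close>

lemma nielsen_reduced_markable:
  assumes dist: "distinct (us @ map inv_word us)"
  shows "\<exists>ms. markable us ms"
proof -
  define R where "R u \<longleftrightarrow> (\<exists>a z b. inv_word z @ b \<in> S \<and> u = a @ z \<and> inv_word z @ b \<noteq> inv_word u \<and>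
    reduced (a @ b) \<and> length a = length z)" for u
  define mark where "mark u = (if R u then length u div 2 - 1 else length u div 2)" for u
  have R_even: "length u = 2 * (length u div 2)" if "R u" for u
    using that by (auto simp: R_def)
  have "markable us (map mark us)"
  proof (rule markableI[OF _ dist])
    fix u assume u: "u \<in> set us"
    show "reduced u" using words u by blast
    show "mark u < length u" using words[OF u] by (cases u) (auto simp: mark_def)
  next
    fix u a z b
    assume u: "u \<in> set us" and y: "inv_word z @ b \<in> set us \<union> inv_word ` set us"
      and eq: "u = a @ z" "inv_word z @ b \<noteq> inv_word u" and ab: "reduced (a @ b)"
    have "length z \<le> length a" using cancellation_le_half[of a z b] u y eq ab by (auto simp: S_def)
    moreover have "R u" if "length z = length a"
      unfolding R_def S_def using y eq ab that by metis
    moreover have "u \<noteq> []" using words[OF u] by simp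
    moreover have "length u = length a + length z" using eq(1) by simp
    moreover have "mark u = length u div 2 - 1" if "R u" using that by (simp add: mark_def)
    moreover have "mark u = length u div 2" if "\<not> R u" using that by (simp add: mark_def)
    moreover have "0 < length u" using calculation(3) by simp
    ultimately show "mark u + length z < length u"
      using R_even[of u] by (cases "R u") linarith+
  next
    fix u a z b
    assume u: "u \<in> set us" and y: "a @ z \<in> set us \<union> inv_word ` set us"
      and eq: "u = inv_word z @ b" "a @ z \<noteq> inv_word u" and ab: "reduced (a @ b)"
    have uS: "u \<in> S" "a @ z \<in> S" using u y by (auto simp: S_def)
    have ne: "inv_word z @ b \<noteq> inv_word (a @ z)" using eq by (metis inv_word_simps(4))
    have zb: "length z \<le> length b"
      using cancellation_le_half(2)[of a z b] uS ne ab eq(1) by simp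
    have "length z \<noteq> length b" if "R u"
    proof
      assume l: "length z = length b"
      from that obtain c w d where R: "inv_word w @ d \<in> S" "u = c @ w" "inv_word w @ d \<noteq> inv_word u"
        "reduced (c @ d)" "length c = length w" by (auto simp: R_def)
      have "length (c @ w) = length (inv_word z @ b)" using eq(1) R(2) by simp
      then have "length c = length (inv_word z)" using R(5) l by simp
      moreover have "c @ w = inv_word z @ b" using eq(1) R(2) by simp
      ultimately have cw: "c = inv_word z" "w = b" by simp_all
      show False
      \<comment> \<open>Here \<open>u\<close> is \<open>inv_word z @ b\<close>: its left half
        cancels against \<open>a @ z\<close> and its right half against
        \<open>inv_word b @ d\<close>.\<close>
      proof (rule no_double_half_cancellation[of "inv_word z" "inv_word b" d a])
        show "inv_word b @ d \<noteq> inv_word z @ inv_word (inv_word b)"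
        proof
          assume "inv_word b @ d = inv_word z @ inv_word (inv_word b)"
          then have "inv_word w @ d = c @ w" by (simp add: cw)
          from cancellation_le_half(3)[OF _ R(1) _ R(4) this] R(2,3,5) uS(1) show False by simp
        qed
        show "a @ inv_word (inv_word z) \<noteq> inv_word z @ inv_word (inv_word b)"
        proof
          assume "a @ inv_word (inv_word z) = inv_word z @ inv_word (inv_word b)"
          then have e: "inv_word z @ b = a @ z" by simp
          from cancellation_le_half(3)[OF uS(2) _ ne ab e] uS(1) eq(1) have "length z < length a" by simp
          with arg_cong[OF e, of length] l show False by simp
        qed
        show "inv_word z @ inv_word (inv_word b) \<in> S" "inv_word b @ d \<in> S" "a @ inv_word (inv_word z) \<in> S"
          using uS R(1) cw eq(1) by simp_all
        show "reduced (inv_word z @ d)" "reduced (a @ inv_word (inv_word b))" using R(4) cw ab by simp_all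
        show "inv_word b @ d \<noteq> inv_word (inv_word z @ inv_word (inv_word b))"
          "a @ inv_word (inv_word z) \<noteq> inv_word (inv_word z @ inv_word (inv_word b))"
          using R(3) eq cw by simp_all
        show "length (inv_word z) = length (inv_word b)" using l by simp
      qed
    qed
    with zb show "length z \<le> mark u" using R_even[of u] eq(1) by (auto simp: mark_def)
  qed
  then show ?thesis by blast
qed

end

end

section \<open>Termination of the reduction\<close>

lemma sum_list_map_update:
  fixes f :: "'b \<Rightarrow> nat"
  assumes "i < length T"
  shows "sum_list (map f (T[i := w])) + f (T ! i) = sum_list (map f T) + f w"
  using assms
proof (induction T arbitrary: i)
  case (Cons x T) then show ?case by (cases i) fastforce+
qed simp

lemma distinct_filter_nth:
  assumes "\<And>i j. i < length T \<Longrightarrow> j < length T \<Longrightarrow> i \<noteq> j \<Longrightarrow> P (T ! i) \<Longrightarrow> T ! i \<noteq> T ! j"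
  shows "distinct (filter P T)"
  using assms
proof (induction T)
  case (Cons x T)
  have "distinct (filter P T)"
  proof (rule Cons.IH)
    fix i j assume "i < length T" "j < length T" "i \<noteq> j" "P (T ! i)"
    then show "T ! i \<noteq> T ! j" using Cons.prems[of "Suc i" "Suc j"] by simp
  qed
  moreover have "x \<notin> set T" if "P x"
  proof
    assume "x \<in> set T"
    then obtain j where "j < length T" "T ! j = x" by (auto simp: in_set_conv_nth)
    then show False using Cons.prems[of 0 "Suc j"] that by simp
  qed
  ultimately show ?case by simp
qed simp

context letter_order begin

text \<open>A move changes one entry, so improving that entry improves the total length, or keeps it
  and improves the total weight. Signed entries that are neither equal nor inverse stem from
  different positions, so without an improving move the non-trivial entries and their inverses form
  a Nielsen reduced set.\<close>

lemma nielsen_reduction: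
  assumes "\<And>u. u \<in> set T \<Longrightarrow> reduced u \<and> set u \<subseteq> \<Sigma>"
  shows "\<exists>cs ms. markable (filter (\<lambda>u. u \<noteq> []) (nielsen word_mult inv_word cs T)) ms"
  using assms
proof (induction T rule: wf_induct_rule[OF wf_measures[of "[\<lambda>T. sum_list (map length T), \<lambda>T. sum_list (map weight T)]"]])
  case (1 T)
  let ?w = "\<lambda>i j p q. word_mult (signed inv_word p (T ! i)) (signed inv_word q (T ! j))"
  let ?better = "\<lambda>i j p q. i < length T \<and> j < length T \<and> i \<noteq> j \<and> (length (?w i j p q) < length (T ! i) \<or>
      length (?w i j p q) = length (T ! i) \<and> weight (?w i j p q) < weight (T ! i))"
  have signed: "reduced (signed inv_word p u)" "set (signed inv_word p u) \<subseteq> \<Sigma>" if "u \<in> set T" for u p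
    using 1(2)[OF that] inv_closed by (auto simp: signed_def set_inv_word)
  show ?case
  proof (cases "\<exists>i j p q. ?better i j p q")
    case True
    then obtain i j p q where b: "?better i j p q" by blast
    define T' where "T' = T[i := ?w i j p q]"
    have "(T', T) \<in> measures [\<lambda>T. sum_list (map length T), \<lambda>T. sum_list (map weight T)]"
      using b sum_list_map_update[of i T length "?w i j p q"] sum_list_map_update[of i T weight "?w i j p q"]
      by (auto simp: T'_def)
    moreover have "reduced u \<and> set u \<subseteq> \<Sigma>" if "u \<in> set T'" for u
    proof (cases "u = ?w i j p q")
      case True
      have "T ! i \<in> set T" "T ! j \<in> set T" using b by auto
      then show ?thesis unfolding True
        using signed set_word_mult[of "signed inv_word p (T ! i)" "signed inv_word q (T ! j)"]
        by (meson reduced_foldr le_sup_iff subset_trans sup.boundedI)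
    next
      case False
      then have "u \<in> set T" using that set_update_subset_insert[of T i "?w i j p q"] by (auto simp: T'_def)
      then show ?thesis using 1(2) by blast
    qed
    ultimately obtain cs ms where
      "markable (filter (\<lambda>u. u \<noteq> []) (nielsen word_mult inv_word cs T')) ms" using 1(1) by blast
    moreover have "T' = nielsen_move word_mult inv_word (i, j, p, q) T"
      using b by (simp add: nielsen_move_eq T'_def)
    ultimately show ?thesis by (metis nielsen_simps(2))
  next
    case False
    let ?us = "filter (\<lambda>u. u \<noteq> []) T" and ?S = "set (filter (\<lambda>u. u \<noteq> []) T) \<union> inv_word ` set (filter (\<lambda>u. u \<noteq> []) T)"
    have len: "length (signed inv_word p u) = length u" and weight: "weight (signed inv_word p u) = weight u" for p u
      by (simp_all add: signed_def)
    have S: "\<exists>i p. i < length T \<and> x = signed inv_word p (T ! i)" if "x \<in> ?S" for x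
      using that by (force simp: in_set_conv_nth signed_def)
    have "nielsen_reduced ?S"
      unfolding nielsen_reduced_def
    proof (intro ballI impI)
      fix x y assume xy: "x \<in> ?S" "y \<in> ?S" "y \<noteq> x" "y \<noteq> inv_word x"
      obtain i p where i: "i < length T" "x = signed inv_word p (T ! i)" using S[OF xy(1)] by blast
      obtain j q where j: "j < length T" "y = signed inv_word q (T ! j)" using S[OF xy(2)] by blast
      have "i \<noteq> j" using xy(3,4) i j by (auto simp: signed_def split: if_splits)
      then have "\<not> (length (word_mult x y) < length x \<or>
          length (word_mult x y) = length x \<and> weight (word_mult x y) < weight x)"
        using False i j len weight by metis
      then show "length x < length (word_mult x y) \<or>
          length x = length (word_mult x y) \<and> weight x \<le> weight (word_mult x y)" by linarith
    qed
    \<comment> \<open>If a non-trivial entry were equal or inverse to another one, a single move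
      would make it trivial and hence shorter.\<close>
    moreover have cancel: "signed inv_word p (T ! i) \<noteq> inv_word (signed inv_word q (T ! j))"
      if "i < length T" "j < length T" "i \<noteq> j" "T ! i \<noteq> []" for i j p q
    proof
      assume "signed inv_word p (T ! i) = inv_word (signed inv_word q (T ! j))"
      then have "?w i j p q = []" using word_mult_inv_right[of "inv_word (signed inv_word q (T ! j))"] by simp
      then have "?better i j p q" using that by simp
      with False show False by blast
    qed
    moreover have "distinct (?us @ map inv_word ?us)"
    proof -
      have "distinct ?us"
      proof (rule distinct_filter_nth)
        fix i j assume "i < length T" "j < length T" "i \<noteq> j" "T ! i \<noteq> []"
        from cancel[OF this, of True False] show "T ! i \<noteq> T ! j" by (simp add: signed_def)
      qed
      moreover have "inv_word u \<noteq> v" if "u \<in> set ?us" "v \<in> set ?us" for u v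
      proof -
        have uv: "u \<in> set T" "v \<in> set T" "u \<noteq> []" using that by auto
        obtain i where i: "i < length T" "u = T ! i" using uv(1) by (metis in_set_conv_nth)
        obtain j where j: "j < length T" "v = T ! j" using uv(2) by (metis in_set_conv_nth)
        show ?thesis
        proof (cases "i = j")
          case True
          then show ?thesis using inv_word_neq[of u] 1(2)[OF uv(1)] uv(3) i(2) j(2) by simp
        next
          case False
          then show ?thesis using cancel[of i j True True] i j uv(3)
            by (simp add: signed_def inv_word_eq_iff)
        qed
      qed
      ultimately show ?thesis by (auto simp: distinct_map inj_on_def)
    qed
    ultimately have "\<exists>ms. markable ?us ms"
      using 1(2) by (intro nielsen_reduced_markable) auto
    then show ?thesis by (metis nielsen_simps(1))
  qed
qed

end

lemma ex_nielsen_reduction: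
  assumes "\<And>u. u \<in> set T \<Longrightarrow> reduced u"
  shows "\<exists>cs ms. markable (filter (\<lambda>u. u \<noteq> []) (nielsen word_mult inv_word cs T)) ms"
proof -
  define \<Sigma> where "\<Sigma> = (\<Union>u\<in>set T. set u \<union> inv_letter ` set u)"
  have "finite \<Sigma>" by (simp add: \<Sigma>_def)
  from finite_imp_inj_to_nat_seg[OF this]
  obtain n and \<kappa> :: "_ \<Rightarrow> nat" where \<kappa>: "\<kappa> ` \<Sigma> = {i. i < n}" "inj_on \<kappa> \<Sigma>"
    by blast
  \<comment> \<open>The base \<open>Suc n\<close> stays positive when no letter occurs at
    all.\<close>
  interpret letter_order "Suc n" \<kappa> \<Sigma>
  proof
    show "\<kappa> s < Suc n" if "s \<in> \<Sigma>" for s using \<kappa>(1) that by (auto intro: less_SucI)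
    show "inv_letter ` \<Sigma> \<subseteq> \<Sigma>" by (auto simp: \<Sigma>_def)
  qed (use \<kappa> in auto)
  show ?thesis using assms by (intro nielsen_reduction) (auto simp: \<Sigma>_def)
qed

section \<open>Free bases and ranks\<close>

lemma word_value_simps [simp]:
  "word_value G [] = \<one>\<^bsub>G\<^esub>"
  "word_value G (s # w) = (if snd s then fst s else inv\<^bsub>G\<^esub> (fst s)) \<otimes>\<^bsub>G\<^esub> word_value G w"
  by (auto simp: word_value_def split: prod.splits)

context group begin

lemma word_value_closed: "letters w \<subseteq> carrier G \<Longrightarrow> word_value G w \<in> carrier G"
  by (induction w) auto

lemma word_value_push_letter:
  assumes "letters (s # w) \<subseteq> carrier G"
  shows "word_value G (push_letter s w) = (if snd s then fst s else inv (fst s)) \<otimes> word_value G w"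
proof (cases w)
  case (Cons t v)
  have "word_value G v \<in> carrier G" "fst s \<in> carrier G" using assms Cons by (auto intro: word_value_closed)
  then show ?thesis using Cons
    by (auto simp: inv_letter_def m_assoc[symmetric])
qed (use assms in auto)

lemma word_value_word_mult:
  assumes "letters u \<subseteq> carrier G" "letters v \<subseteq> carrier G"
  shows "word_value G (word_mult u v) = word_value G u \<otimes> word_value G v"
  using assms(1)
proof (induction u)
  case (Cons s u)
  then have "letters (s # word_mult u v) \<subseteq> carrier G" using assms(2) letters_foldr[of u v] by auto
  with Cons assms(2) show ?case
    by (auto simp: word_value_push_letter m_assoc word_value_closed)
qed (use assms(2) word_value_closed in auto)

lemma word_value_hom: "B \<subseteq> carrier G \<Longrightarrow> word_value G \<in> hom (free_group B) G"
  by (rule homI) (auto simp: word_value_closed word_value_word_mult subset_trans)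

lemma word_value_image:
  assumes B: "B \<subseteq> carrier G"
  shows "word_value G ` carrier (free_group B) = generate G B"
proof
  have "word_value G w \<in> generate G B" if "letters w \<subseteq> B" for w
    using that
  proof (induction w)
    case (Cons s w)
    then show ?case by (auto intro!: generate.eng intro: generate.incl generate.inv)
  qed (auto intro: generate.one)
  then show "word_value G ` carrier (free_group B) \<subseteq> generate G B" by auto
  show "generate G B \<subseteq> word_value G ` carrier (free_group B)"
  proof
    fix x assume "x \<in> generate G B"
    then show "x \<in> word_value G ` carrier (free_group B)"
    proof (induction rule: generate.induct)
      case one then show ?case by (intro image_eqI[of _ _ "[]"]) auto
    next
      case (incl h) then show ?case using B
        by (intro image_eqI[of _ _ "[(h, True)]"]) (auto simp: reduced_Cons)
    next
      case (inv h) then show ?case using B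
        by (intro image_eqI[of _ _ "[(h, False)]"]) (auto simp: reduced_Cons)
    next
      case (eng h1 h2)
      then obtain u v where "u \<in> carrier (free_group B)" "h1 = word_value G u"
        "v \<in> carrier (free_group B)" "h2 = word_value G v" by blast
      moreover from this have "word_mult u v \<in> carrier (free_group B)"
        using monoid.m_closed[OF group.is_monoid[OF group_free_group], of u B v] by simp
      ultimately show ?case using B
        by (intro image_eqI[of _ _ "word_mult u v"]) (auto simp: word_value_word_mult)
    qed
  qed
qed

lemma word_value_subgroup_generated:
  assumes "letters w \<subseteq> carrier (subgroup_generated G K)"
  shows "word_value (subgroup_generated G K) w = word_value G w"
  using assms by (induction w) auto

lemma free_basis_subgroup_generated:
  assumes B: "B \<subseteq> carrier G" "generate G B = generate G (carrier G \<inter> K)"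
    and free: "\<And>z. reduced z \<Longrightarrow> letters z \<subseteq> B \<Longrightarrow> z \<noteq> [] \<Longrightarrow> word_value G z \<noteq> \<one>"
  shows "free_basis (subgroup_generated G K) B"
proof -
  let ?K = "subgroup_generated G K"
  have K: "carrier ?K = generate G B" using B(2) by (simp add: carrier_subgroup_generated)
  have BK: "B \<subseteq> carrier ?K" unfolding K by (auto intro: generate.incl)
  interpret K: group ?K by (rule group_subgroup_generated)
  have eq: "word_value ?K w = word_value G w" if "w \<in> carrier (free_group B)" for w
    using that BK by (intro word_value_subgroup_generated) auto
  note image = word_value_image[OF B(1)]
  interpret group_hom "free_group B" G "word_value G"
    using word_value_hom[OF B(1)] is_group group_free_group
    by (intro group_hom.intro group_hom_axioms.intro)
  have "kernel (free_group B) G (word_value G) = {\<one>\<^bsub>free_group B\<^esub>}"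
    using free by (auto simp: kernel_def)
  then have "inj_on (word_value G) (carrier (free_group B))" by (rule trivial_ker_imp_inj)
  then have "inj_on (word_value ?K) (carrier (free_group B))"
    using inj_on_cong[of "carrier (free_group B)" "word_value ?K" "word_value G"] eq by blast
  moreover have "word_value ?K ` carrier (free_group B) = carrier ?K"
    using eq image K by (metis (no_types, lifting) image_cong)
  ultimately show ?thesis
    using K.word_value_hom[OF BK] BK by (simp add: free_basis_def iso_def bij_betw_def)
qed

text \<open>The homomorphisms to \<open>\<int>/2\<close>, extended by \<open>False\<close> outside of the carrier. Counting them shows
  that the rank is well defined.\<close>

definition parity_homs :: "('a \<Rightarrow> bool) set" where
  "parity_homs = {\<chi>. (\<forall>x. x \<notin> carrier G \<longrightarrow> \<not> \<chi> x) \<and>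
     (\<forall>x\<in>carrier G. \<forall>y\<in>carrier G. \<chi> (x \<otimes> y) = (\<chi> x \<noteq> \<chi> y))}"

lemma parity_homD:
  assumes "\<chi> \<in> parity_homs"
  shows "x \<in> carrier G \<Longrightarrow> y \<in> carrier G \<Longrightarrow> \<chi> (x \<otimes> y) = (\<chi> x \<noteq> \<chi> y)" "\<not> \<chi> \<one>"
    "x \<in> carrier G \<Longrightarrow> \<chi> (inv x) = \<chi> x"
proof -
  show m: "\<chi> (x \<otimes> y) = (\<chi> x \<noteq> \<chi> y)" if "x \<in> carrier G" "y \<in> carrier G" for x y
    using assms that by (simp add: parity_homs_def)
  from m[of \<one> \<one>] show one: "\<not> \<chi> \<one>" by simp
  show "\<chi> (inv x) = \<chi> x" if "x \<in> carrier G" using m[of x "inv x"] that one by simp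
qed

lemma parity_hom_word_value:
  assumes "\<chi> \<in> parity_homs" "letters w \<subseteq> carrier G"
  shows "\<chi> (word_value G w) = odd (length (filter (\<lambda>s. \<chi> (fst s)) w))"
  using assms(2)
  by (induction w) (auto simp: parity_homD[OF assms(1)] word_value_closed)

text \<open>By freeness, a homomorphism to the group of order two corresponds to an arbitrary subset
  of the basis, the elements that it sends to the non-trivial element.\<close>

lemma card_parity_homs:
  assumes "free_basis G B" "finite B"
  shows "card parity_homs = 2 ^ card B"
proof -
  have B: "B \<subseteq> carrier G" and iso: "word_value G \<in> iso (free_group B) G"
    using assms(1) by (auto simp: free_basis_def)
  let ?W = "carrier (free_group B)"
  define code where "code = inv_into ?W (word_value G)"
  have bij: "bij_betw (word_value G) ?W (carrier G)" using iso by (simp add: iso_def)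
  have code: "code x \<in> ?W" "word_value G (code x) = x" if "x \<in> carrier G" for x
  proof -
    have "x \<in> word_value G ` ?W" using that bij_betw_imp_surj_on[OF bij] by simp
    then show "code x \<in> ?W" "word_value G (code x) = x"
      unfolding code_def by (rule inv_into_into, rule f_inv_into_f)
  qed
  have code_eq: "code (word_value G w) = w" if "w \<in> ?W" for w
    using that bij unfolding code_def by (simp add: bij_betw_def)
  have odd_mult: "odd (length (filter P (word_mult u v))) =
      (odd (length (filter P u)) \<noteq> odd (length (filter P v)))" if "\<And>s. P (inv_letter s) = P s" for P and u v :: "'a word"
  proof -
    have "odd (length (filter P (push_letter s w))) = (P s \<noteq> odd (length (filter P w)))" for s w
      by (cases w) (auto simp: that)
    then show ?thesis by (induction u) auto
  qed
  have "bij_betw (\<lambda>\<chi>. {b \<in> B. \<chi> b}) parity_homs (Pow B)"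
  proof (intro bij_betwI')
    fix \<chi> \<psi> assume h: "\<chi> \<in> parity_homs" "\<psi> \<in> parity_homs"
    show "({b \<in> B. \<chi> b} = {b \<in> B. \<psi> b}) = (\<chi> = \<psi>)"
    proof
      assume eq: "{b \<in> B. \<chi> b} = {b \<in> B. \<psi> b}"
      have "\<chi> x = \<psi> x" for x
      proof (cases "x \<in> carrier G")
        case True
        have "letters (code x) \<subseteq> B" using code(1)[OF True] by simp
        then have "filter (\<lambda>s. \<chi> (fst s)) (code x) = filter (\<lambda>s. \<psi> (fst s)) (code x)"
          using eq by (intro filter_cong refl) (force simp: letters_def)
        then show ?thesis
          using parity_hom_word_value[OF h(1), of "code x"] parity_hom_word_value[OF h(2), of "code x"]
            code[OF True] B by auto
      qed (use h in \<open>auto simp: parity_homs_def\<close>)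
      then show "\<chi> = \<psi>" by blast
    qed simp
  next
    fix C assume C: "C \<in> Pow B"
    \<comment> \<open>The parity of the number of letters from \<open>C\<close> is additive, because
      cancellation removes a letter together with its inverse.\<close>
    define \<chi> where "\<chi> x \<longleftrightarrow> x \<in> carrier G \<and> odd (length (filter (\<lambda>s. fst s \<in> C) (code x)))" for x
    have "code (x \<otimes> y) = word_mult (code x) (code y)" if "x \<in> carrier G" "y \<in> carrier G" for x y
    proof -
      have "word_mult (code x) (code y) \<in> ?W"
        using monoid.m_closed[OF group.is_monoid[OF group_free_group], of "code x" B "code y"] code that by simp
      moreover have "word_value G (word_mult (code x) (code y)) = x \<otimes> y"
        using code that B word_value_word_mult[of "code x" "code y"] by auto
      ultimately show ?thesis using code_eq by metis
    qed
    then have "\<chi> \<in> parity_homs"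
      by (auto simp: parity_homs_def \<chi>_def odd_mult)
    moreover have "code b = [(b, True)]" if "b \<in> B" for b
      using code_eq[of "[(b, True)]"] that B by (auto simp: reduced_Cons)
    then have "C = {b \<in> B. \<chi> b}" using C B by (auto simp: \<chi>_def split: if_splits)
    ultimately show "\<exists>\<chi>\<in>parity_homs. C = {b \<in> B. \<chi> b}" by blast
  qed auto
  then show ?thesis using bij_betw_same_card card_Pow[OF assms(2)] by metis
qed

lemma has_rank_unique:
  assumes "has_rank G m" "has_rank G n" shows "m = n"
proof -
  have "card parity_homs = 2 ^ m" "card parity_homs = 2 ^ n"
    using assms card_parity_homs unfolding has_rank_def by auto
  then have "(2::nat) ^ m = 2 ^ n" by simp
  then show ?thesis by simp
qed

end

section \<open>Nielsen moves under homomorphisms and on generating sets\<close>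

lemma nielsen_hom:
  assumes "\<And>x y. f (m x y) = m' (f x) (f y)" "\<And>x. f (v x) = v' (f x)"
  shows "map f (nielsen m v cs T) = nielsen m' v' cs (map f T)"
proof -
  have signed: "f (signed v p x) = signed v' p (f x)" for p x by (simp add: signed_def assms(2))
  have move: "map f (nielsen_move m v c T) = nielsen_move m' v' c (map f T)" for c T
    by (cases c) (auto simp: nielsen_move_eq map_update assms(1) signed)
  show ?thesis by (induction cs arbitrary: T) (simp_all add: move)
qed

lemma set_nielsen_move:
  assumes "\<And>x y. Q x \<Longrightarrow> Q y \<Longrightarrow> Q (m x y)" "\<And>x. Q x \<Longrightarrow> Q (v x)" "\<forall>x\<in>set T. Q x"
  shows "\<forall>x\<in>set (nielsen_move m v c T). Q x"
proof -
  obtain i j p q where c: "c = (i, j, p, q)" by (metis prod_cases4)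
  show ?thesis
  proof (cases "i \<noteq> j \<and> i < length T \<and> j < length T")
    case True
    then have "Q (T ! i)" "Q (T ! j)" using assms(3) by auto
    then have "Q (m (signed v p (T ! i)) (signed v q (T ! j)))"
      using assms(1,2) by (simp add: signed_def)
    then show ?thesis
      using True assms(3) set_update_subset_insert[of T i] unfolding c nielsen_move_eq by fastforce
  next
    case False
    then have "nielsen_move m v c T = T" unfolding c nielsen_move_eq by (rule if_not_P)
    then show ?thesis using assms(3) by simp
  qed
qed

lemma set_nielsen:
  assumes "\<And>x y. Q x \<Longrightarrow> Q y \<Longrightarrow> Q (m x y)" "\<And>x. Q x \<Longrightarrow> Q (v x)" "\<forall>x\<in>set T. Q x"
  shows "\<forall>x\<in>set (nielsen m v cs T). Q x"
  using assms(3)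
proof (induction cs arbitrary: T)
  case (Cons c cs)
  then show ?case using set_nielsen_move[of Q m v T c, OF assms(1,2)] by simp
qed simp

lemma length_nielsen [simp]: "length (nielsen m v cs T) = length T"
proof (induction cs arbitrary: T)
  case (Cons c cs)
  then show ?case by (cases c) (simp add: nielsen_move_eq)
qed simp

context group begin

lemma generate_eqI:
  assumes "A \<subseteq> carrier G" "A \<subseteq> generate G B" "B \<subseteq> carrier G" "B \<subseteq> generate G A"
  shows "generate G A = generate G B"
  using generate_subgroup_incl[OF assms(2) generate_is_subgroup[OF assms(3)]]
    generate_subgroup_incl[OF assms(4) generate_is_subgroup[OF assms(1)]] by blast

lemma generate_filter_one:
  assumes "set T \<subseteq> carrier G"
  shows "generate G (set (filter (\<lambda>x. x \<noteq> \<one>) T)) = generate G (set T)"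
proof (rule generate_eqI)
  show "set T \<subseteq> generate G (set (filter (\<lambda>x. x \<noteq> \<one>) T))"
    using generate.incl[of _ "set (filter (\<lambda>x. x \<noteq> \<one>) T)" G] generate.one by fastforce
qed (use assms in \<open>auto intro: generate.incl\<close>)

text \<open>Agreement of \<open>m\<close> and \<open>v\<close> with the group operations is asked
  only on the carrier, since \<open>inv_word\<close> and \<open>inv_syls\<close> are known to be the
  group inverses only there.\<close>

lemma generate_nielsen:
  assumes m: "\<And>x y. x \<in> carrier G \<Longrightarrow> y \<in> carrier G \<Longrightarrow> m x y = x \<otimes> y"
    and v: "\<And>x. x \<in> carrier G \<Longrightarrow> v x = inv x"
    and T: "set T \<subseteq> carrier G"
  shows "generate G (set (nielsen m v cs T)) = generate G (set T)"
    "set (nielsen m v cs T) \<subseteq> carrier G"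
proof -
  have closed: "set (nielsen_move m v c T) \<subseteq> carrier G" if "set T \<subseteq> carrier G" for c T
    using set_nielsen_move[of "\<lambda>x. x \<in> carrier G" m v T c] m v that by auto
  have move: "generate G (set (nielsen_move m v c T)) = generate G (set T)" if T: "set T \<subseteq> carrier G" for c T
  proof -
    obtain i j p q where c: "c = (i, j, p, q)" by (metis prod_cases4)
    show ?thesis
    proof (cases "i \<noteq> j \<and> i < length T \<and> j < length T")
      case True
      define x where "x = signed v p (T ! i)"
      define y where "y = signed v q (T ! j)"
      define T' where "T' = T[i := m x y]"
      have in_T: "T ! i \<in> set T" "T ! j \<in> set T" using True by auto
      then have TC: "T ! i \<in> carrier G" "T ! j \<in> carrier G" using T by auto
      have xy: "x \<in> carrier G" "y \<in> carrier G" using TC v by (auto simp: x_def y_def signed_def)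
      have T': "nielsen_move m v c T = T'" using True by (simp add: c nielsen_move_eq T'_def x_def y_def)
      have signed_gen: "signed v r z \<in> generate G Z" if "z \<in> generate G Z" "Z \<subseteq> carrier G" for r z Z
        using that v[of z] generate_m_inv_closed[OF that(2,1)] generate_in_carrier[OF that(2,1)]
        by (auto simp: signed_def)
      have "generate G (set T') = generate G (set T)"
      proof (rule generate_eqI[OF _ _ T])
        show T'C: "set T' \<subseteq> carrier G" using closed[OF T, of c] T' by simp
        have "x \<in> generate G (set T)" "y \<in> generate G (set T)"
          unfolding x_def y_def by (rule signed_gen[OF generate.incl T], rule in_T)+
        then have "m x y \<in> generate G (set T)" using m[OF xy] by (simp add: generate.eng)
        then show "set T' \<subseteq> generate G (set T)"
          using set_update_subset_insert[of T i "m x y"] generate.incl[of _ "set T" G]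
          unfolding T'_def by blast
        have nth: "T' ! k \<in> generate G (set T')" if "k < length T" for k
          using that nth_mem[of k T'] by (intro generate.incl) (simp add: T'_def)
        have "T ! j \<in> generate G (set T')" using nth[of j] True by (simp add: T'_def)
        then have y: "y \<in> generate G (set T')" unfolding y_def by (rule signed_gen[OF _ T'C])
        have mxy: "m x y \<in> generate G (set T')" using nth[of i] True by (simp add: T'_def)
        \<comment> \<open>The move is undone by dividing by \<open>y\<close>, which is still
          available because the entry at position \<open>j\<close> has not changed.\<close>
        have "x = m x y \<otimes> inv y" using xy m[OF xy] by (simp add: m_assoc)
        then have "x \<in> generate G (set T')"
          using generate.eng[OF mxy generate_m_inv_closed[OF T'C y]] by simp
        then have "signed v p x \<in> generate G (set T')" by (rule signed_gen[OF _ T'C])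
        moreover have "signed v p x = T ! i" using TC v by (simp add: x_def signed_def)
        ultimately have Ti: "T ! i \<in> generate G (set T')" by simp
        show "set T \<subseteq> generate G (set T')"
        proof
          fix z assume "z \<in> set T"
          then obtain k where k: "k < length T" "z = T ! k" by (metis in_set_conv_nth)
          show "z \<in> generate G (set T')"
            using Ti nth[OF k(1)] k by (cases "k = i") (simp_all add: T'_def)
        qed
      qed
      then show ?thesis by (simp add: T')
    next
      case False
      then have "nielsen_move m v c T = T" unfolding c nielsen_move_eq by (rule if_not_P)
      then show ?thesis by simp
    qed
  qed
  have "generate G (set (nielsen m v cs T)) = generate G (set T) \<and> set (nielsen m v cs T) \<subseteq> carrier G"
    using T
  proof (induction cs arbitrary: T)
    case (Cons c cs)
    then show ?case using Cons.IH[OF closed[OF Cons.prems, of c]] move[OF Cons.prems, of c] by simp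
  qed simp
  then show "generate G (set (nielsen m v cs T)) = generate G (set T)"
    "set (nielsen m v cs T) \<subseteq> carrier G" by simp_all
qed

end

text \<open>Modulo the normal closure of the elements \<open>b\<close> with \<open>h b = \<one>\<close>, the group is generated by the
  remaining elements of \<open>T\<close>, whose images are free; hence the kernel is no larger.\<close>

lemma (in group_hom) kernel_eq_normal_closure:
  assumes T: "set T \<subseteq> carrier G" "generate G (set T) = carrier G"
    and dist: "distinct (filter (\<lambda>y. y \<noteq> \<one>\<^bsub>H\<^esub>) (map h T))"
    and free: "\<And>z. reduced z \<Longrightarrow> letters z \<subseteq> set (map h T) - {\<one>\<^bsub>H\<^esub>} \<Longrightarrow> z \<noteq> [] \<Longrightarrow>
      word_value H z \<noteq> \<one>\<^bsub>H\<^esub>"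
  shows "kernel G H h = normal_closure G (set (filter (\<lambda>x. h x = \<one>\<^bsub>H\<^esub>) T))"
proof
  let ?R = "set (filter (\<lambda>x. h x = \<one>\<^bsub>H\<^esub>) T)" and ?B = "set (filter (\<lambda>x. h x \<noteq> \<one>\<^bsub>H\<^esub>) T)"
  have B: "?B \<subseteq> carrier G" using T(1) by auto
  show "normal_closure G ?R \<subseteq> kernel G H h"
    unfolding normal_closure_def using normal_kernel T(1) by (intro Inter_lower) (auto simp: kernel_def)
  have inj: "inj_on h ?B"
    using dist by (simp add: filter_map distinct_map comp_def)
  have trivial: "v = \<one>" if v: "v \<in> generate G ?B" "h v = \<one>\<^bsub>H\<^esub>" for v
  proof -
    obtain z where z: "z \<in> carrier (free_group ?B)" "v = word_value G z"
      using v(1) G.word_value_image[OF B] by blast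
    have eq: "h (word_value G w) = word_value H (map (map_prod h id) w)" if "letters w \<subseteq> carrier G" for w
      using that by (induction w) (auto simp: G.word_value_closed)
    have "letters z \<subseteq> carrier G" using z(1) B by auto
    then have "word_value H (map (map_prod h id) z) = \<one>\<^bsub>H\<^esub>" using v(2) z(2) eq by simp
    \<comment> \<open>Different letters of \<open>z\<close> could become equal under
      \<open>h\<close> and create a cancelling pair; injectivity of \<open>h\<close> on the
      remaining generators excludes this.\<close>
    moreover have "reduced (map (map_prod h id) z)"
    proof -
      have "map_prod h id t \<noteq> inv_letter (map_prod h id s)" if "t \<noteq> inv_letter s" "s \<in> set z" "t \<in> set z" for s t
      proof -
        have "fst s \<in> ?B" "fst t \<in> ?B" using z(1) that(2,3) by (auto simp: letters_def)
        then show ?thesis using that(1) inj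
          by (cases s; cases t) (auto simp: inv_letter_def dest: inj_onD)
      qed
      moreover have "z ! Suc i \<noteq> inv_letter (z ! i)" if "Suc i < length z" for i
        using z(1) that by (simp add: reduced_def successively_conv_nth)
      ultimately show ?thesis unfolding reduced_def successively_conv_nth by simp
    qed
    moreover have "letters (map (map_prod h id) z) \<subseteq> set (map h T) - {\<one>\<^bsub>H\<^esub>}"
    proof
      fix y assume "y \<in> letters (map (map_prod h id) z)"
      moreover have "letters (map (map_prod h id) z) = h ` letters z"
        by (simp add: letters_def image_image)
      ultimately obtain b where "b \<in> letters z" "y = h b" by auto
      then show "y \<in> set (map h T) - {\<one>\<^bsub>H\<^esub>}" using z(1) by auto
    qed
    ultimately have "z = []" using free[of "map (map_prod h id) z"] by auto
    then show ?thesis using z(2) by simp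
  qed
  show "kernel G H h \<subseteq> normal_closure G ?R"
    unfolding normal_closure_def
  proof (intro Inter_greatest subsetI)
    fix N x assume "N \<in> {N. N \<lhd> G \<and> ?R \<subseteq> N}" and x: "x \<in> kernel G H h"
    then have N: "N \<lhd> G" "?R \<subseteq> N" by auto
    \<comment> \<open>Intersecting with the kernel gives \<open>h n = \<one>\<close> for the factor
      \<open>n\<close> in \<open>M\<close>. Then \<open>h v = h x\<close> is trivial too, and
      freeness of the images applies to \<open>v\<close>.\<close>
    define M where "M = N \<inter> kernel G H h"
    have M: "M \<lhd> G" "?R \<subseteq> M" "M \<subseteq> N"
      unfolding M_def using N normal_kernel T(1) G.normal_subgroup_intersect by (auto simp: kernel_def)
    have sub: "subgroup (M <#> generate G ?B) G"
      using G.mult_norm_subgroup[OF M(1) G.generate_is_subgroup[OF B]] .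
    have oneM: "\<one> \<in> M" using M(1) by (simp add: normal_imp_subgroup subgroup.one_closed)
    have "set T \<subseteq> M <#> generate G ?B"
    proof
      fix y assume y: "y \<in> set T"
      then have yc: "y \<in> carrier G" using T(1) by auto
      show "y \<in> M <#> generate G ?B"
      proof (cases "h y = \<one>\<^bsub>H\<^esub>")
        case True
        then have "y \<in> M" using M(2) y by auto
        then have "y \<otimes> \<one> \<in> M <#> generate G ?B" unfolding set_mult_def using generate.one by blast
        then show ?thesis using yc by simp
      next
        case False
        then have "y \<in> generate G ?B" using y by (intro generate.incl) auto
        then have "\<one> \<otimes> y \<in> M <#> generate G ?B" unfolding set_mult_def using oneM by blast
        then show ?thesis using yc by simp
      qed
    qed
    from G.generate_subgroup_incl[OF this sub] T(2)
    have "carrier G \<subseteq> M <#> generate G ?B" by simp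
    then obtain n v where nv: "n \<in> M" "v \<in> generate G ?B" "x = n \<otimes> v"
      using x unfolding set_mult_def kernel_def by auto
    have nc: "n \<in> carrier G" "h n = \<one>\<^bsub>H\<^esub>" using nv(1) by (auto simp: M_def kernel_def)
    have vc: "v \<in> carrier G" using G.generate_in_carrier[OF B nv(2)] .
    have "h v = \<one>\<^bsub>H\<^esub>" using x nc vc nv(3) by (simp add: kernel_def)
    then have "v = \<one>" using trivial nv(2) by blast
    then show "x \<in> N" using nv nc M(3) by auto
  qed
qed

section \<open>The algorithm\<close>

definition cons_syl :: "'a word + int \<Rightarrow> ('a word + int) list \<Rightarrow> ('a word + int) list" where
  "cons_syl s w = (if s = Inl [] \<or> s = Inr 0 then w else s # w)"

text \<open>The subgroup determines which syllables are allowed but not how they multiply. This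
  version mentions neither \<open>A\<close> nor \<open>H\<close>, so it can be run without deciding
  membership in \<open>H\<close>.\<close>

definition push_syl :: "'a word + int \<Rightarrow> ('a word + int) list \<Rightarrow> ('a word + int) list" where
  "push_syl s w = (case w of [] \<Rightarrow> cons_syl s [] | t # w' \<Rightarrow>
     (case s of
        Inl a \<Rightarrow> (case t of Inl b \<Rightarrow> cons_syl (Inl (word_mult a b)) w' | Inr _ \<Rightarrow> cons_syl s w)
      | Inr k \<Rightarrow> (case t of Inl _ \<Rightarrow> cons_syl s w | Inr l \<Rightarrow> cons_syl (Inr (k + l)) w')))"

definition inv_syl :: "'a word + int \<Rightarrow> 'a word + int" where
  "inv_syl s = (case s of Inl a \<Rightarrow> Inl (inv_word a) | Inr k \<Rightarrow> Inr (- k))"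

definition inv_syls :: "('a word + int) list \<Rightarrow> ('a word + int) list" where
  "inv_syls w = rev (map inv_syl w)"

lemma push_syllable_eq:
  "push_syllable (subgroup_generated (free_group A) H) integer_group s w = push_syl s w"
  by (cases s; cases w; cases "hd w") (auto simp: push_syl_def cons_syl_def cons_syllable_def)

lemma adjoin_variable_simps:
  "monoid.mult (adjoin_variable (free_group A) H) = foldr push_syl"
  "\<one>\<^bsub>adjoin_variable (free_group A) H\<^esub> = []"
  by (auto simp: adjoin_variable_def free_product_def push_syllable_eq[abs_def] intro!: ext foldr_cong)

lemma adjoin_variable_carrier:
  assumes "subgroup H (free_group A)"
  shows "w \<in> carrier (adjoin_variable (free_group A) H) \<longleftrightarrow>
    set w \<subseteq> Inl ` (H - {[]}) \<union> Inr ` (- {0}) \<and> successively (\<lambda>s t. isl s \<noteq> isl t) w"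
  using subgroup.carrier_subgroup_generated_subgroup[OF assms]
  by (auto simp: adjoin_variable_def free_product_def Compl_eq_Diff_UNIV)

context
  fixes A :: "'a set" and H :: "'a word set"
  assumes H: "subgroup H (free_group A)"
begin

private abbreviation (input) "F \<equiv> free_group A"
private abbreviation (input) "P \<equiv> adjoin_variable (free_group A) H"

interpretation F: group F by (rule group_free_group)
interpretation P: group P by (rule group_adjoin_variable[OF group_free_group])

lemma H_words: "h \<in> H \<Longrightarrow> reduced h \<and> letters h \<subseteq> A"
  using subsetD[OF subgroup.subset[OF H], of h] by simp

lemma H_closed: "a \<in> H \<Longrightarrow> b \<in> H \<Longrightarrow> word_mult a b \<in> H" "a \<in> H \<Longrightarrow> inv_word a \<in> H" "[] \<in> H"
proof -
  show "a \<in> H \<Longrightarrow> b \<in> H \<Longrightarrow> word_mult a b \<in> H" using subgroup.m_closed[OF H] by simp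
  show "inv_word a \<in> H" if "a \<in> H"
    using subgroup.m_inv_closed[OF H that] inv_free_group[OF subsetD[OF subgroup.subset[OF H] that]]
    by metis
  show "[] \<in> H" using subgroup.one_closed[OF H] by simp
qed

lemma P_Cons: "s # w \<in> carrier P \<longleftrightarrow>
    s \<in> Inl ` (H - {[]}) \<union> Inr ` (- {0}) \<and> (w = [] \<or> isl s \<noteq> isl (hd w)) \<and> w \<in> carrier P"
  by (auto simp: adjoin_variable_carrier[OF H] successively_Cons)

lemma P_Nil: "[] \<in> carrier P"
  by (simp add: adjoin_variable_carrier[OF H])

lemma cons_syl_P: "h \<in> H \<Longrightarrow> cons_syl (Inl h) [] \<in> carrier P" "cons_syl (Inr k) [] \<in> carrier P"
  by (auto simp: cons_syl_def P_Cons P_Nil)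

lemma inv_syls: "w \<in> carrier P \<Longrightarrow> inv_syls w \<in> carrier P \<and> foldr push_syl (inv_syls w) w = []"
proof (induction w)
  case (Cons s w)
  then have s: "s \<in> Inl ` (H - {[]}) \<union> Inr ` (- {0})" and w: "w \<in> carrier P" by (auto simp: P_Cons)
  have left: "word_mult (inv_word u) u = []" for u :: "'a word"
    using word_mult_inv_right[of "inv_word u"] by simp
  have "push_syl (inv_syl s) (s # w) = w"
    using s by (auto simp: inv_syl_def push_syl_def cons_syl_def left)
  moreover have "inv_syls (s # w) \<in> carrier P"
  proof -
    have "set (inv_syls (s # w)) \<subseteq> Inl ` (H - {[]}) \<union> Inr ` (- {0})"
    proof -
      have "inv_syl t \<in> Inl ` (H - {[]}) \<union> Inr ` (- {0})"
        if "t \<in> Inl ` (H - {[]}) \<union> Inr ` (- {0})" for t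
        using that H_closed(2) by (cases t) (auto simp: inv_syl_def)
      note inv_syl = this
      have sub: "set (s # w) \<subseteq> Inl ` (H - {[]}) \<union> Inr ` (- {0})"
        using Cons.prems unfolding adjoin_variable_carrier[OF H] by blast
      show ?thesis
      proof
        fix t assume "t \<in> set (inv_syls (s # w))"
        then obtain u where u: "u \<in> set (s # w)" "t = inv_syl u" by (auto simp: inv_syls_def)
        show "t \<in> Inl ` (H - {[]}) \<union> Inr ` (- {0})"
          unfolding u(2) by (rule inv_syl[OF subsetD[OF sub u(1)]])
      qed
    qed
    moreover have "successively (\<lambda>s t. isl s \<noteq> isl t) (inv_syls (s # w))"
    proof -
      have isl: "isl (inv_syl t) = isl t" for t :: "'a word + int" by (cases t) (auto simp: inv_syl_def)
      have "successively (\<lambda>s t. isl s \<noteq> isl t) (s # w)"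
        using Cons.prems unfolding adjoin_variable_carrier[OF H] by blast
      then show ?thesis
        unfolding inv_syls_def successively_rev successively_map isl by (simp add: eq_commute)
    qed
    ultimately show ?thesis unfolding adjoin_variable_carrier[OF H] by blast
  qed
  ultimately show ?case using Cons.IH[OF w] by (simp add: inv_syls_def)
qed (simp add: inv_syls_def P_Nil)

lemma inv_P: "w \<in> carrier P \<Longrightarrow> inv\<^bsub>P\<^esub> w = inv_syls w"
  using inv_syls[of w] by (intro P.inv_equality) (simp_all add: adjoin_variable_simps)

lemma push_syl_P: "s # w \<in> carrier P \<Longrightarrow> push_syl s w = s # w"
  by (auto simp: P_Cons push_syl_def cons_syl_def split: list.splits sum.splits)

text \<open>A normal form is the product of its syllables, so single syllables suffice. As
  \<open>cons_syl\<close> turns the empty word into the identity, the induction over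
  \<open>generate\<close> never meets an invalid syllable; powers of \<open>x\<close> are reached by
  induction on the exponent in both directions.\<close>

lemma generate_P:
  assumes U: "generate F U = H" "U \<subseteq> carrier F"
  shows "generate P (insert [Inr 1] ((\<lambda>u. cons_syl (Inl u) []) ` U)) = carrier P"
proof -
  let ?S = "insert [Inr 1] ((\<lambda>u. cons_syl (Inl u) []) ` U)"
  have UH: "U \<subseteq> H" using generate.incl[of _ U F] U(1) by blast
  have x: "[Inr 1] = cons_syl (Inr 1) []" by (simp add: cons_syl_def)
  have S: "?S \<subseteq> carrier P" using cons_syl_P(1) cons_syl_P(2)[of 1, folded x] UH by auto
  have mult: "a \<in> generate P ?S \<Longrightarrow> b \<in> generate P ?S \<Longrightarrow> foldr push_syl a b \<in> generate P ?S" for a b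
    using generate.eng[of a P ?S b] by (simp add: adjoin_variable_simps)
  have one: "[] \<in> generate P ?S" using generate.one[of P ?S] by (simp add: adjoin_variable_simps)
  have invs: "a \<in> ?S \<Longrightarrow> inv_syls a \<in> generate P ?S" for a
    using generate.inv[of a ?S P] inv_P S by auto
  have "cons_syl (Inl h) [] \<in> generate P ?S" if "h \<in> generate F U" for h
    using that
  proof (induction rule: generate.induct)
    case one then show ?case using \<open>[] \<in> generate P ?S\<close> by (simp add: cons_syl_def)
  next
    case (incl h) then show ?case by (intro generate.incl) auto
  next
    case (inv h)
    then have "inv_syls (cons_syl (Inl h) []) \<in> generate P ?S" by (intro invs) auto
    moreover have "inv\<^bsub>F\<^esub> h = inv_word h" using subsetD[OF U(2)] inv by (intro inv_free_group)
    ultimately show ?case by (auto simp: cons_syl_def inv_syls_def inv_syl_def)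
  next
    case (eng h1 h2)
    then have "foldr push_syl (cons_syl (Inl h1) []) (cons_syl (Inl h2) []) \<in> generate P ?S"
      by (intro mult)
    moreover have "reduced h1" using eng(1) U H_words by blast
    then have "word_mult h1 [] = h1" by (simp add: word_mult_reduced)
    ultimately show ?case by (auto simp: cons_syl_def push_syl_def split: if_splits)
  qed
  then have Inl: "[Inl h] \<in> generate P ?S" if "h \<in> H" "h \<noteq> []" for h
    using that U(1) by (force simp: cons_syl_def)
  have Inr: "cons_syl (Inr k) [] \<in> generate P ?S" for k
  proof (induction k rule: int_induct[of _ 0])
    case base then show ?case using one by (simp add: cons_syl_def)
  next
    case (step1 i)
    have "foldr push_syl [Inr 1] (cons_syl (Inr i) []) \<in> generate P ?S"
      using step1(2) by (intro mult) (auto intro: generate.incl)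
    then show ?case by (auto simp: cons_syl_def push_syl_def add.commute split: if_splits)
  next
    case (step2 i)
    have "foldr push_syl (inv_syls [Inr 1]) (cons_syl (Inr i) []) \<in> generate P ?S"
      using step2(2) invs[of "[Inr 1]"] by (intro mult) auto
    then show ?case by (auto simp: cons_syl_def push_syl_def inv_syls_def inv_syl_def split: if_splits)
  qed
  have "w \<in> generate P ?S" if "w \<in> carrier P" for w
    using that
  proof (induction w)
    case (Cons s w)
    then have s: "s \<in> Inl ` (H - {[]}) \<union> Inr ` (- {0})" and w: "w \<in> carrier P" by (auto simp: P_Cons)
    have "[s] \<in> generate P ?S"
    proof (cases s)
      case (Inl h) then show ?thesis using s Inl \<open>\<And>h. h \<in> H \<Longrightarrow> h \<noteq> [] \<Longrightarrow> [Inl h] \<in> generate P ?S\<close> by auto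
    next
      case (Inr k)
      then have "cons_syl s [] = [s]" using s by (auto simp: cons_syl_def)
      then show ?thesis using Inr \<open>\<And>k. cons_syl (Inr k) [] \<in> generate P ?S\<close>[of k] by metis
    qed
    from mult[OF this Cons.IH[OF w]] show ?case using push_syl_P[OF Cons.prems] by simp
  qed (rule one)
  then show ?thesis using P.generate_incl[OF S] by blast
qed

end

section \<open>Freeness from marks and the search problem\<close>

lemma markable_free:
  assumes "markable us ms" "set us \<subseteq> carrier (free_group A)"
  shows "distinct us"
    "reduced z \<Longrightarrow> letters z \<subseteq> set us \<Longrightarrow> z \<noteq> [] \<Longrightarrow> word_value (free_group A) z \<noteq> []"
proof -
  have m: "marked (mark_at us ms)" and us: "map unmark (mark_at us ms) = us"
    using assms(1) by (auto simp: markable_def)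
  show "distinct us" using m us by (auto simp: marked_def)
  have us': "unmark ` set (mark_at us ms) = set us" using arg_cong[OF us, of set] by simp
  have t: "unmark t \<in> carrier (free_group A)" if "t \<in> set (mark_at us ms)" for t
    using subsetD[OF assms(2), of "unmark t"] us' that by blast
  assume z: "reduced z" "letters z \<subseteq> set us" "z \<noteq> []"
  then obtain x z' where "z = x # z'" by (cases z) auto
  then show "word_value (free_group A) z \<noteq> []"
    using marked_word_value[OF m, of A x z'] t z us' by auto
qed

text \<open>Marked words are a free basis of whatever subgroup they generate. Hence a rank can be
  read off as the length of an accepted list.\<close>

lemma markable_has_rank:
  assumes "markable us ms" "set us \<subseteq> carrier (free_group A)"
    "generate (free_group A) (set us) = generate (free_group A) (carrier (free_group A) \<inter> K)"
  shows "has_rank (subgroup_generated (free_group A) K) (length us)"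
proof -
  have "free_basis (subgroup_generated (free_group A) K) (set us)"
    using assms(2,3) markable_free(2)[OF assms(1,2)]
    by (intro group.free_basis_subgroup_generated[OF group_free_group]) auto
  then show ?thesis
    using markable_free(1)[OF assms(1,2)] distinct_card unfolding has_rank_def by blast
qed

text \<open>The moves act on elements of \<open>H * \<langle>x\<rangle>\<close> (second component) along with their values at
  \<open>x = g\<close> (first component).\<close>

definition pair_mult where
  "pair_mult p q = (word_mult (fst p) (fst q), foldr push_syl (snd p) (snd q))"

definition pair_inv where
  "pair_inv p = (inv_word (fst p), inv_syls (snd p))"

definition with_variable :: "'a word list \<Rightarrow> 'a word \<Rightarrow> ('a word \<times> ('a word + int) list) list" where
  "with_variable us g = (g, [Inr 1]) # map (\<lambda>u. (u, cons_syl (Inl u) [])) us"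

text \<open>What the algorithm searches for: moves and marks that reduce the generators of \<open>H\<close>, then moves
  and marks that reduce the resulting basis together with \<open>g\<close>.\<close>

type_synonym nielsen_data = "(nielsen_move list \<times> nat list) \<times> (nielsen_move list \<times> nat list)"

definition subgroup_basis :: "'a word list \<Rightarrow> nielsen_data \<Rightarrow> 'a word list" where
  "subgroup_basis hs c = filter (\<lambda>u. u \<noteq> []) (nielsen word_mult inv_word (fst (fst c)) hs)"

definition reduced_system ::
  "'a word list \<Rightarrow> 'a word \<Rightarrow> nielsen_data \<Rightarrow> ('a word \<times> ('a word + int) list) list" where
  "reduced_system hs g c =
    nielsen pair_mult pair_inv (fst (snd c)) (with_variable (subgroup_basis hs c) g)"

text \<open>Both conditions are decidable. Neither mentions the ranks, which appear only as the
  lengths of the two marked lists.\<close>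

definition accepts :: "'a word list \<Rightarrow> 'a word \<Rightarrow> nielsen_data \<Rightarrow> bool" where
  "accepts hs g c \<longleftrightarrow> markable (subgroup_basis hs c) (snd (fst c)) \<and>
     markable (filter (\<lambda>u. u \<noteq> []) (map fst (reduced_system hs g c))) (snd (snd c))"

definition relators :: "'a word list \<Rightarrow> 'a word \<Rightarrow> nielsen_data \<Rightarrow> ('a word + int) list list" where
  "relators hs g c = map snd (filter (\<lambda>t. fst t = []) (reduced_system hs g c))"

lemma map_fst_reduced_system:
  "map fst (reduced_system hs g c) =
    nielsen word_mult inv_word (fst (snd c)) (g # subgroup_basis hs c)"
  unfolding reduced_system_def
  by (subst nielsen_hom[where m' = word_mult and v' = inv_word])
    (simp_all add: pair_mult_def pair_inv_def with_variable_def comp_def)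

lemma map_snd_reduced_system:
  "map snd (reduced_system hs g c) = nielsen (foldr push_syl) inv_syls (fst (snd c))
    ([Inr 1] # map (\<lambda>u. cons_syl (Inl u) []) (subgroup_basis hs c))"
  unfolding reduced_system_def
  by (subst nielsen_hom[where m' = "foldr push_syl" and v' = inv_syls])
    (simp_all add: pair_mult_def pair_inv_def with_variable_def comp_def)

lemma ex_accepts:
  assumes "\<And>u. u \<in> set hs \<Longrightarrow> reduced u" "reduced g"
  shows "\<exists>c. accepts hs g c"
proof -
  obtain cs1 ms1 where 1: "markable (filter (\<lambda>u. u \<noteq> []) (nielsen word_mult inv_word cs1 hs)) ms1"
    using ex_nielsen_reduction assms(1) by blast
  define us where "us = filter (\<lambda>u. u \<noteq> []) (nielsen word_mult inv_word cs1 hs)"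
  have "\<forall>u\<in>set (nielsen word_mult inv_word cs1 hs). reduced u"
    using assms(1) by (intro set_nielsen) (auto simp: word_mult_carrier)
  then have "reduced u" if "u \<in> set (g # us)" for u using that assms(2) by (auto simp: us_def)
  then obtain cs2 ms2 where 2: "markable (filter (\<lambda>u. u \<noteq> []) (nielsen word_mult inv_word cs2 (g # us))) ms2"
    using ex_nielsen_reduction by blast
  have "accepts hs g ((cs1, ms1), (cs2, ms2))"
    using 1 2 unfolding accepts_def map_fst_reduced_system subgroup_basis_def us_def by simp
  then show ?thesis by blast
qed

text \<open>The system has \<open>n + 1\<close> entries, one for \<open>x\<close> and
  \<open>n\<close> for the basis of \<open>H\<close>. By the marks and uniqueness of rank,
  \<open>m\<close> of them have non-trivial value; the others are the relators. The ideal is the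
  kernel of evaluation, to which \<open>kernel_eq_normal_closure\<close> applies.\<close>

lemma relators_correct:
  assumes H: "subgroup H (free_group A)" and hs: "generate (free_group A) (set hs) = H" "set hs \<subseteq> H"
    and n: "has_rank (subgroup_generated (free_group A) H) n"
    and g: "g \<in> carrier (free_group A)"
    and m: "has_rank (subgroup_generated (free_group A) (insert g H)) m"
    and c: "accepts hs g c"
  shows "length (relators hs g c) = n + 1 - m"
    "set (relators hs g c) \<subseteq> carrier (adjoin_variable (free_group A) H)"
    "ideal_over (free_group A) H g = normal_closure (adjoin_variable (free_group A) H) (set (relators hs g c))"
proof -
  let ?F = "free_group A" and ?P = "adjoin_variable (free_group A) H" and ?h = "evaluate (free_group A) g"
  interpret F: group ?F by (rule group_free_group)
  interpret P: group ?P by (rule group_adjoin_variable[OF group_free_group])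
  interpret h: group_hom ?P ?F ?h
    using evaluate_hom[OF group_free_group H g] P.is_group F.is_group
    by (intro group_hom.intro group_hom_axioms.intro)
  define us where "us = subgroup_basis hs c"
  define T where "T = reduced_system hs g c"
  have HF: "H \<subseteq> carrier ?F" using H by (rule subgroup.subset)
  have Fmult: "word_mult x y = x \<otimes>\<^bsub>?F\<^esub> y" for x y by simp
  have Finv: "x \<in> carrier ?F \<Longrightarrow> inv_word x = inv\<^bsub>?F\<^esub> x" for x by (rule inv_free_group[symmetric])
  have nielsen_F: "generate ?F (set (filter (\<lambda>u. u \<noteq> []) (nielsen word_mult inv_word cs L))) = generate ?F (set L)"
      "set (filter (\<lambda>u. u \<noteq> []) (nielsen word_mult inv_word cs L)) \<subseteq> carrier ?F"
    if L: "set L \<subseteq> carrier ?F" for cs L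
  proof -
    note N = F.generate_nielsen[OF Fmult Finv L, of cs]
    show "generate ?F (set (filter (\<lambda>u. u \<noteq> []) (nielsen word_mult inv_word cs L))) = generate ?F (set L)"
      using F.generate_filter_one[OF N(2)] N(1) by simp
    show "set (filter (\<lambda>u. u \<noteq> []) (nielsen word_mult inv_word cs L)) \<subseteq> carrier ?F"
      using N(2) by auto
  qed
  have us: "generate ?F (set us) = H" "set us \<subseteq> carrier ?F"
    using nielsen_F[of hs "fst (fst c)"] hs HF unfolding us_def subgroup_basis_def by auto
  have usH: "set us \<subseteq> H" using generate.incl[of _ "set us" ?F] us(1) by blast
  have m1: "markable us (snd (fst c))" and m2: "markable (filter (\<lambda>u. u \<noteq> []) (map fst T)) (snd (snd c))"
    using c by (auto simp: accepts_def us_def T_def)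
  have T_fst: "map fst T = nielsen word_mult inv_word (fst (snd c)) (g # us)"
    by (simp add: T_def us_def map_fst_reduced_system)
  have T_snd: "map snd T = nielsen (foldr push_syl) inv_syls (fst (snd c))
      ([Inr 1] # map (\<lambda>u. cons_syl (Inl u) []) us)"
    by (simp add: T_def us_def map_snd_reduced_system)
  have gus: "set (g # us) \<subseteq> carrier ?F" using g us(2) by auto
  have vs: "generate ?F (set (filter (\<lambda>u. u \<noteq> []) (map fst T))) = generate ?F (set (g # us))"
    "set (filter (\<lambda>u. u \<noteq> []) (map fst T)) \<subseteq> carrier ?F"
    unfolding T_fst using nielsen_F[OF gus] by blast+
  have "generate ?F (carrier ?F \<inter> H) = H"
    using subgroup.carrier_subgroup_generated_subgroup[OF H] by (simp add: carrier_subgroup_generated)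
  then have "has_rank (subgroup_generated ?F H) (length us)"
    using markable_has_rank[OF m1 us(2)] us(1) by simp
  then have n_eq: "n = length us"
    using group.has_rank_unique[OF F.group_subgroup_generated n] by simp
  have "generate ?F (set (g # us)) = generate ?F (carrier ?F \<inter> insert g H)"
  proof (rule F.generate_eqI[OF gus])
    show "set (g # us) \<subseteq> generate ?F (carrier ?F \<inter> insert g H)"
      using gus usH by (auto intro: generate.incl)
    have "H \<subseteq> generate ?F (set (g # us))"
      using us(1) F.mono_generate[of "set us" "set (g # us)"] by auto
    then show "carrier ?F \<inter> insert g H \<subseteq> generate ?F (set (g # us))"
      by (auto intro: generate.incl)
  qed auto
  then have "has_rank (subgroup_generated ?F (insert g H)) (length (filter (\<lambda>u. u \<noteq> []) (map fst T)))"
    using markable_has_rank[OF m2 vs(2)] vs(1) by simp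
  then have m_eq: "m = length (filter (\<lambda>u. u \<noteq> []) (map fst T))"
    using group.has_rank_unique[OF F.group_subgroup_generated m] by simp
  have "length (map fst T) = Suc n" unfolding T_fst n_eq by simp
  moreover have "length (filter (\<lambda>t. fst t = []) T) + length (filter (\<lambda>t. fst t \<noteq> []) T) = length T"
    by (rule sum_length_filter_compl)
  ultimately show "length (relators hs g c) = n + 1 - m"
    by (simp add: relators_def T_def[symmetric] m_eq filter_map comp_def)
  have S: "set ([Inr 1] # map (\<lambda>u. cons_syl (Inl u) []) us) \<subseteq> carrier ?P"
  proof -
    have "[Inr 1] \<in> carrier ?P" using cons_syl_P(2)[OF H, of 1] by (simp add: cons_syl_def)
    then show ?thesis using cons_syl_P(1)[OF H] usH by auto
  qed
  have Pinv: "w \<in> carrier ?P \<Longrightarrow> inv_syls w = inv\<^bsub>?P\<^esub> w" for w using inv_P[OF H] by simp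
  have Pmult: "foldr push_syl x y = x \<otimes>\<^bsub>?P\<^esub> y" for x y by (simp add: adjoin_variable_simps)
  have TP: "set (map snd T) \<subseteq> carrier ?P"
    unfolding T_snd by (rule P.generate_nielsen(2)[OF Pmult Pinv S])
  have T_gen: "generate ?P (set (map snd T)) = carrier ?P"
    using P.generate_nielsen(1)[OF Pmult Pinv S, of "fst (snd c)"] generate_P[OF H us]
    unfolding T_snd by simp
  \<comment> \<open>Evaluation is a homomorphism, so every move preserves the relation that the
    first component is the value of the second at \<open>x = g\<close>.\<close>
  have "\<forall>t\<in>set T. snd t \<in> carrier ?P \<and> fst t = ?h (snd t)"
    unfolding T_def reduced_system_def us_def[symmetric]
  proof (rule set_nielsen)
    show "\<forall>t\<in>set (with_variable us g). snd t \<in> carrier ?P \<and> fst t = ?h (snd t)"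
    proof -
      have "?h (cons_syl (Inl u) []) = u" if "u \<in> H" for u
        using evaluate_inclusion[OF group_free_group H that, of g] h.hom_one
        by (auto simp: cons_syl_def adjoin_variable_simps)
      then show ?thesis
        using S usH evaluate_variable[OF group_free_group g] by (auto simp: with_variable_def)
    qed
  next
    fix s t assume "snd s \<in> carrier ?P \<and> fst s = ?h (snd s)" "snd t \<in> carrier ?P \<and> fst t = ?h (snd t)"
    then show "snd (pair_mult s t) \<in> carrier ?P \<and> fst (pair_mult s t) = ?h (snd (pair_mult s t))"
      using h.hom_mult[of "snd s" "snd t"] P.m_closed[of "snd s" "snd t"]
      by (simp add: pair_mult_def adjoin_variable_simps)
  next
    fix t assume t: "snd t \<in> carrier ?P \<and> fst t = ?h (snd t)"
    then have "?h (snd t) \<in> carrier ?F" using h.hom_closed by blast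
    from Finv[OF this] have "fst (pair_inv t) = inv\<^bsub>?F\<^esub> ?h (snd t)"
      unfolding pair_inv_def using t by (simp only: fst_conv)
    moreover have "snd (pair_inv t) = inv\<^bsub>?P\<^esub> snd t"
      unfolding pair_inv_def using Pinv[of "snd t"] t by (simp only: snd_conv)
    moreover have "?h (inv\<^bsub>?P\<^esub> snd t) = inv\<^bsub>?F\<^esub> ?h (snd t)"
      using h.hom_inv t by blast
    moreover have "inv\<^bsub>?P\<^esub> snd t \<in> carrier ?P" using P.inv_closed t by blast
    ultimately show "snd (pair_inv t) \<in> carrier ?P \<and> fst (pair_inv t) = ?h (snd (pair_inv t))"
      by metis
  qed
  then have T_eval: "fst t = ?h (snd t)" if "t \<in> set T" for t using that by blast
  have map_h: "map ?h (map snd T) = map fst T" using T_eval by simp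
  have rel: "relators hs g c = filter (\<lambda>x. ?h x = []) (map snd T)"
    unfolding relators_def T_def[symmetric] filter_map comp_def
    using T_eval by (intro arg_cong[of _ _ "map snd"] filter_cong) auto
  show "set (relators hs g c) \<subseteq> carrier ?P" unfolding rel using TP by auto
  have "ideal_over ?F H g = kernel ?P ?F ?h" by (simp add: ideal_over_def kernel_def)
  also have "\<dots> = normal_closure ?P (set (filter (\<lambda>x. ?h x = \<one>\<^bsub>?F\<^esub>) (map snd T)))"
  proof (rule h.kernel_eq_normal_closure[OF TP T_gen])
    show "distinct (filter (\<lambda>y. y \<noteq> \<one>\<^bsub>?F\<^esub>) (map ?h (map snd T)))"
      unfolding map_h using markable_free(1)[OF m2 vs(2)] by simp
    fix z assume "reduced z" "letters z \<subseteq> set (map ?h (map snd T)) - {\<one>\<^bsub>?F\<^esub>}" "z \<noteq> []"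
    then show "word_value ?F z \<noteq> \<one>\<^bsub>?F\<^esub>"
      using markable_free(2)[OF m2 vs(2), of z] unfolding map_h by auto
  qed
  finally show "ideal_over ?F H g = normal_closure ?P (set (relators hs g c))" by (simp add: rel)
qed

section \<open>Computability of the algorithm\<close>

lemma push_letter_eq:
  "push_letter s w = (case w of [] \<Rightarrow> [s] | t # w' \<Rightarrow> if t = inv_letter s then w' else s # w)"
  by (cases w) auto

text \<open>Multiplying the letters into the empty word performs all cancellations, and reduced
  words are its fixed points. In this form \<open>reduced\<close> inherits computability and
  invariance under renaming from \<open>push_letter\<close>.\<close>

lemma reduced_eq: "reduced w \<longleftrightarrow> word_mult w [] = w"
  using reduced_foldr[of "[]" w] word_mult_reduced[of w "[]"] by auto

lemma computable_inv_letter [computable_intros]: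
  "computable s \<Longrightarrow> computable (\<lambda>c. inv_letter (s c))"
  unfolding inv_letter_def by (intro computable_intros)

lemma computable_push_letter [computable_intros]:
  assumes "computable s" "computable w" shows "computable (\<lambda>c. push_letter (s c) (w c))"
  unfolding push_letter_eq
  by (intro computable_intros computable_comp[OF assms(1)] computable_comp[OF assms(2)] assms)

lemma computable_inv_word [computable_intros]:
  "computable w \<Longrightarrow> computable (\<lambda>c. inv_word (w c))"
  unfolding inv_word_def by (intro computable_intros)

lemma computable_reduced [computable_intros]: "computable w \<Longrightarrow> computable (\<lambda>c. reduced (w c))"
  unfolding reduced_eq by (intro computable_intros)

lemma computable_unmark [computable_intros]: "computable t \<Longrightarrow> computable (\<lambda>c. unmark (t c))"
  unfolding unmark_def by (intro computable_intros)

lemma computable_inv_fac [computable_intros]: "computable t \<Longrightarrow> computable (\<lambda>c. inv_fac (t c))"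
  unfolding inv_fac_def by (intro computable_intros)

lemma computable_compatible [computable_intros]:
  assumes "computable t" "computable t'" shows "computable (\<lambda>c. compatible (t c) (t' c))"
  unfolding compatible_def by (intro computable_intros computable_comp[OF assms(2)] assms)

lemma computable_marked [computable_intros]:
  assumes "computable ts" shows "computable (\<lambda>c. marked (ts c))"
  unfolding marked_def by (intro computable_intros computable_comp[OF assms] assms)

lemma computable_mark_at [computable_intros]:
  "computable us \<Longrightarrow> computable ms \<Longrightarrow> computable (\<lambda>c. mark_at (us c) (ms c))"
  unfolding mark_at_def by (intro computable_intros)

lemma computable_markable [computable_intros]:
  "computable us \<Longrightarrow> computable ms \<Longrightarrow> computable (\<lambda>c. markable (us c) (ms c))"
  unfolding markable_def by (intro computable_intros)

lemma computable_nielsen: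
  assumes m: "computable (\<lambda>z. m (fst z) (snd z))" and v: "computable v"
    and cs: "computable cs" and T: "computable T"
  shows "computable (\<lambda>c. nielsen m v (cs c) (T c))"
proof -
  have m': "computable (\<lambda>c. m (f c) (g c))" if "computable f" "computable g" for f g :: "'x::encodable \<Rightarrow> _"
    using computable_comp[OF m computable_Pair[OF that]] by simp
  show ?thesis
    unfolding nielsen_def nielsen_move_def signed_def
    by (intro computable_intros m' computable_comp[OF v] cs T)
qed

lemma computable_cons_syl [computable_intros]:
  "computable s \<Longrightarrow> computable w \<Longrightarrow> computable (\<lambda>c. cons_syl (s c) (w c))"
  unfolding cons_syl_def by (intro computable_intros)

lemma computable_push_syl [computable_intros]:
  assumes "computable s" "computable w" shows "computable (\<lambda>c. push_syl (s c) (w c))"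
  unfolding push_syl_def
  by (intro computable_intros computable_comp[OF assms(1)] computable_comp[OF assms(2)] assms)

lemma computable_inv_syls [computable_intros]:
  "computable w \<Longrightarrow> computable (\<lambda>c. inv_syls (w c))"
  unfolding inv_syls_def inv_syl_def by (intro computable_intros)

lemma computable_subgroup_basis [computable_intros]:
  "computable hs \<Longrightarrow> computable d \<Longrightarrow> computable (\<lambda>c. subgroup_basis (hs c) (d c))"
  unfolding subgroup_basis_def by (intro computable_intros computable_nielsen)

lemma computable_reduced_system [computable_intros]:
  "computable hs \<Longrightarrow> computable g \<Longrightarrow> computable d \<Longrightarrow>
    computable (\<lambda>c. reduced_system (hs c) (g c) (d c))"
  unfolding reduced_system_def pair_mult_def[abs_def] pair_inv_def[abs_def] with_variable_def
  by (intro computable_intros computable_nielsen)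

lemma computable_accepts [computable_intros]:
  "computable hs \<Longrightarrow> computable g \<Longrightarrow> computable d \<Longrightarrow>
    computable (\<lambda>c. accepts (hs c) (g c) (d c))"
  unfolding accepts_def by (intro computable_intros)

lemma computable_relators [computable_intros]:
  "computable hs \<Longrightarrow> computable g \<Longrightarrow> computable d \<Longrightarrow>
    computable (\<lambda>c. relators (hs c) (g c) (d c))"
  unfolding relators_def by (intro computable_intros)

lemma ex_decoder_nielsen_data: "\<exists>d :: nat \<Rightarrow> nielsen_data. computable d \<and> surj d"
proof -
  note move = decoder_prod[OF decoder_nat decoder_prod[OF decoder_nat decoder_prod[OF decoder_bool decoder_bool]]]
  note half = decoder_prod[OF decoder_list[OF move] decoder_list[OF decoder_nat]]
  show ?thesis using decoder_prod[OF half half] by blast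
qed

section \<open>Invariance under renaming of letters\<close>

context
  includes lifting_syntax
  fixes R :: "'a \<Rightarrow> 'b \<Rightarrow> bool"
  assumes R [transfer_rule]: "bi_unique R"
begin

private abbreviation (input) "letter_rel \<equiv> rel_prod R ((=) :: bool \<Rightarrow> bool \<Rightarrow> bool)"
private abbreviation (input) "word_rel \<equiv> list_all2 (rel_prod R ((=) :: bool \<Rightarrow> bool \<Rightarrow> bool))"
private abbreviation (input) "syl_rel \<equiv>
  rel_sum (list_all2 (rel_prod R ((=) :: bool \<Rightarrow> bool \<Rightarrow> bool))) ((=) :: int \<Rightarrow> int \<Rightarrow> bool)"

lemma inv_letter_transfer [transfer_rule]: "(letter_rel ===> letter_rel) inv_letter inv_letter"
  unfolding inv_letter_def[abs_def] by transfer_prover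

lemma push_letter_transfer [transfer_rule]:
  "(letter_rel ===> word_rel ===> word_rel) push_letter push_letter"
  unfolding push_letter_eq[abs_def] by transfer_prover

lemma inv_word_transfer [transfer_rule]: "(word_rel ===> word_rel) inv_word inv_word"
  unfolding inv_word_def[abs_def] by transfer_prover

lemma reduced_transfer [transfer_rule]: "(word_rel ===> (=)) reduced reduced"
  unfolding reduced_eq[abs_def] by transfer_prover

lemma markable_transfer [transfer_rule]:
  "(list_all2 word_rel ===> (=) ===> (=)) markable markable"
  unfolding markable_def[abs_def] marked_def[abs_def] mark_at_def[abs_def] compatible_def[abs_def]
    inv_fac_def[abs_def] unmark_def[abs_def]
  by transfer_prover

lemma nielsen_transfer [transfer_rule]:
  "((Q ===> Q ===> Q) ===> (Q ===> Q) ===> (=) ===> list_all2 Q ===> list_all2 Q) nielsen nielsen"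
  unfolding nielsen_def[abs_def] nielsen_move_def[abs_def] signed_def[abs_def] by transfer_prover

lemma push_syl_transfer [transfer_rule]:
  "(syl_rel ===> list_all2 syl_rel ===> list_all2 syl_rel) push_syl push_syl"
  unfolding push_syl_def[abs_def] cons_syl_def[abs_def] by transfer_prover

lemma inv_syls_transfer [transfer_rule]: "(list_all2 syl_rel ===> list_all2 syl_rel) inv_syls inv_syls"
  unfolding inv_syls_def[abs_def] inv_syl_def[abs_def] by transfer_prover

lemma reduced_system_transfer [transfer_rule]:
  "(list_all2 word_rel ===> word_rel ===> (=) ===> list_all2 (rel_prod word_rel (list_all2 syl_rel)))
    reduced_system reduced_system"
  unfolding reduced_system_def[abs_def] pair_mult_def[abs_def] pair_inv_def[abs_def]
    with_variable_def[abs_def] subgroup_basis_def[abs_def] cons_syl_def[abs_def]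
  by transfer_prover

text \<open>A candidate consists of indices, positions and signs, and the check inspects letters
  only by comparing them; for a bi-unique relation of letters the same candidate serves both
  sides.\<close>

lemma accepts_transfer: "(list_all2 word_rel ===> word_rel ===> (=) ===> (=)) accepts accepts"
  unfolding accepts_def[abs_def] subgroup_basis_def[abs_def] by transfer_prover

lemma relators_transfer:
  "(list_all2 word_rel ===> word_rel ===> (=) ===> list_all2 (list_all2 syl_rel)) relators relators"
  unfolding relators_def[abs_def] by transfer_prover

end

section \<open>Codes of renamed input and output\<close>

lemma word_code_eq: "word_code e w = enc (map (map_prod e id) w)"
  by (simp add: word_code_def comp_def case_prod_unfold)

lemma input_code_eq:
  "input_code e hs g = enc (map (map (map_prod e id)) hs, map (map_prod e id) g)"
  by (simp add: input_code_def word_code_eq[abs_def] comp_def)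

lemma list_all2_eq_map:
  assumes "list_all2 R xs ys" "\<And>x y. R x y \<Longrightarrow> f x = g y" shows "map f xs = map g ys"
  using assms by (induction rule: list_all2_induct) auto

text \<open>Related letters satisfy \<open>k = e a\<close>, so numbering the original output by
  \<open>e\<close> and encoding the renamed output yield the same number.\<close>

lemma output_code_eq:
  assumes "list_all2 (list_all2 (rel_sum (list_all2 (rel_prod (\<lambda>a k. k = e a \<and> a \<in> L) (=))) (=))) ws ws'"
  shows "output_code e ws = enc ws'"
proof -
  have word: "word_code e w = enc w'" if "list_all2 (rel_prod (\<lambda>a k. k = e a \<and> a \<in> L) (=)) w w'" for w w'
    using list_all2_eq_map[OF that, of "map_prod e id" id] by (auto simp: word_code_eq)
  have syl: "syllable_code e s = enc s'"
    if "rel_sum (list_all2 (rel_prod (\<lambda>a k. k = e a \<and> a \<in> L) (=))) (=) s s'" for s s'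
    using that by (cases s; cases s') (auto simp: syllable_code_def word enc_int_def simp del: enc_list_def)
  have "map (syllable_code e) w = map enc w'"
    if "list_all2 (rel_sum (list_all2 (rel_prod (\<lambda>a k. k = e a \<and> a \<in> L) (=))) (=)) w w'" for w w'
    using list_all2_eq_map[OF that] syl by blast
  then have "map (\<lambda>w. list_encode (map (syllable_code e) w)) ws = map enc ws'"
    using list_all2_eq_map[OF assms, of "\<lambda>w. list_encode (map (syllable_code e) w)" enc] by simp
  then show ?thesis by (simp add: output_code_def)
qed

theorem theorem5p2:
  fixes A :: "'a set"
  shows "\<exists>alg. partial_recursive alg \<and>
    (\<forall>(e :: 'a \<Rightarrow> nat) (hs :: 'a word list) (g :: 'a word) (H :: 'a word set) (n :: nat) (m :: nat).
      inj_on e (\<Union>w\<in>set (g # hs). letters w) \<and>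
      subgroup H (free_group A) \<and>
      set hs \<subseteq> H \<and> generate (free_group A) (set hs) = H \<and>
      has_rank (subgroup_generated (free_group A) H) n \<and>
      g \<in> carrier (free_group A) \<and> g \<noteq> \<one>\<^bsub>free_group A\<^esub> \<and>
      dependent_on (free_group A) H g \<and>
      has_rank (subgroup_generated (free_group A) (insert g H)) m \<and> m \<le> n \<longrightarrow>
      (\<exists>ws. alg (input_code e hs g) = Some (output_code e ws) \<and>
        length ws = n + 1 - m \<and>
        set ws \<subseteq> carrier (adjoin_variable (free_group A) H) \<and>
        ideal_over (free_group A) H g =
          normal_closure (adjoin_variable (free_group A) H) (set ws)))"
proof -
  obtain d :: "nat \<Rightarrow> nielsen_data" where d: "computable d" "surj d"
    using ex_decoder_nielsen_data by blast
  \<comment> \<open>The search is set up on words over the natural numbers, before any numbering or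
    subgroup is chosen, so one algorithm serves all inputs.\<close>
  have "computable (\<lambda>z :: (nat word list \<times> nat word) \<times> nielsen_data.
      accepts (fst (fst z)) (snd (fst z)) (snd z))"
    "computable (\<lambda>z :: (nat word list \<times> nat word) \<times> nielsen_data.
      relators (fst (fst z)) (snd (fst z)) (snd z))"
    by (intro computable_intros)+
  then have "\<exists>alg. partial_recursive alg \<and> (\<forall>x :: nat word list \<times> nat word.
      (\<exists>c. accepts (fst x) (snd x) c) \<longrightarrow>
      (\<exists>c. accepts (fst x) (snd x) c \<and> alg (enc x) = Some (enc (relators (fst x) (snd x) c))))"
    using d by (intro partial_recursive_search[where P = "\<lambda>x. accepts (fst x) (snd x)"
          and out = "\<lambda>x. relators (fst x) (snd x)"])
  then obtain alg where alg: "partial_recursive alg"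
    "\<And>hs (g :: nat word). \<exists>c. accepts hs g c \<Longrightarrow>
      \<exists>c. accepts hs g c \<and> alg (enc (hs, g)) = Some (enc (relators hs g c))"
    by fastforce
  show ?thesis
  proof (intro exI[of _ alg] conjI allI impI alg(1), elim conjE)
    fix e :: "'a \<Rightarrow> nat" and hs :: "'a word list" and g :: "'a word" and H and n m
    assume inj: "inj_on e (\<Union>w\<in>set (g # hs). letters w)" and H: "subgroup H (free_group A)"
      and hs: "set hs \<subseteq> H" "generate (free_group A) (set hs) = H"
      and n: "has_rank (subgroup_generated (free_group A) H) n"
      and g: "g \<in> carrier (free_group A)"
      and m: "has_rank (subgroup_generated (free_group A) (insert g H)) m"
    define L where "L = (\<Union>w\<in>set (g # hs). letters w)"
    \<comment> \<open>This is the graph of \<open>e\<close> cut down to the letters of the input,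
      where \<open>e\<close> is known to be injective; so \<open>R\<close> is bi-unique.\<close>
    define R where "R a k \<longleftrightarrow> k = e a \<and> a \<in> L" for a k
    define hs' where "hs' = map (map (map_prod e id)) hs"
    define g' where "g' = map (map_prod e id) g"
    have R: "bi_unique R"
      using inj_onD[OF inj[folded L_def]] by (auto simp: bi_unique_def R_def)
    have word: "list_all2 (rel_prod R (=)) w (map (map_prod e id) w)" if "letters w \<subseteq> L" for w
      using that by (induction w) (auto simp: R_def)
    have rel: "list_all2 (list_all2 (rel_prod R (=))) hs hs'" "list_all2 (rel_prod R (=)) g g'"
    proof -
      show "list_all2 (rel_prod R (=)) g g'" unfolding g'_def by (rule word) (auto simp: L_def)
      show "list_all2 (list_all2 (rel_prod R (=))) hs hs'"
      proof -
        have "list_all2 (list_all2 (rel_prod R (=))) us (map (map (map_prod e id)) us)"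
          if "\<forall>u\<in>set us. letters u \<subseteq> L" for us
          using that by (induction us) (auto intro: word)
        then show ?thesis unfolding hs'_def by (auto simp: L_def)
      qed
    qed
    have acc: "accepts hs g c \<longleftrightarrow> accepts hs' g' c" for c
      using accepts_transfer[OF R] rel by (auto dest!: rel_funD)
    \<comment> \<open>A candidate exists for the original words, while the search runs on the
      renamed ones; \<open>acc\<close> translates in both directions.\<close>
    have "\<exists>c. accepts hs g c"
      using hs(1) g subgroup.subset[OF H] by (intro ex_accepts) auto
    then obtain c where c: "accepts hs' g' c" "alg (enc (hs', g')) = Some (enc (relators hs' g' c))"
      using alg(2) acc by blast
    have "list_all2 (list_all2 (rel_sum (list_all2 (rel_prod R (=))) (=))) (relators hs g c) (relators hs' g' c)"
      using relators_transfer[OF R] rel by (auto dest!: rel_funD)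
    then have out: "output_code e (relators hs g c) = enc (relators hs' g' c)"
      unfolding R_def[abs_def] by (rule output_code_eq)
    have "input_code e hs g = enc (hs', g')" by (simp only: input_code_eq hs'_def g'_def)
    then have "alg (input_code e hs g) = Some (output_code e (relators hs g c))"
      using c(2) out by simp
    then show "\<exists>ws. alg (input_code e hs g) = Some (output_code e ws) \<and>
        length ws = n + 1 - m \<and> set ws \<subseteq> carrier (adjoin_variable (free_group A) H) \<and>
        ideal_over (free_group A) H g = normal_closure (adjoin_variable (free_group A) H) (set ws)"
      using relators_correct[OF H hs(2,1) n g m] c(1) acc by blast
  qed
qed

end
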